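(* Let $G$ be a connected vertex-weighted graph with vertex set $V(G)=\{v_1,v_2,\ldots,v_n\}$ and vertex-weight function $\omega:V(G)\to\mathbb{R}^+$ (positive reals) satisfying $\omega(v_i)=x_i$ for each $v_i\in V(G)$. Then the weighted Kirchhoff index of $G$, $K(G;x_1,x_2,\ldots,x_n)=\sum_{1\le i<j\le n}x_ix_j\,r_G(v_i,v_j)$, satisfies $$K(G;x_1,x_2,\ldots,x_n)=\frac{1}{\tau(G)}\Bigg[m\big(S(G)^{\omega^\ast},n-2\big)\prod_{i=1}^n x_i+\sum_{C\in\mathcal C(G)}(-2)^{p(C)}\,m\big(S(G)^{\omega^\ast}-S(C),\,n-2-|C|\big)\prod_{v_i\notin V(C)}x_i\Bigg].$$
   Context: Graphs are finite and simple. Resistance distance: for a connected graph $G$ and vertices $u,v$, $r_G(u,v)$ is the effective resistance between $u$ and $v$ in the electrical network obtained from $G$ by regarding each edge as a unit resistor. $\tau(G)$ is the number of spanning trees of $G$. Subdivision graph: $S(G)$ is the graph obtained from $G$ by inserting one additional vertex $e^*$ into each edge $e$ of $G$; that is, $V(S(G))=V(G)\cup\{e^*\mid e\in E(G)\}$ and $E(S(G))=\{ue^*,ve^*\mid e=uv\in E(G)\}$. Weighted subdivision graph: $S(G)^{\omega^\ast}$ is the edge-weighted graph obtained from $S(G)$ by giving each edge $v_ie^*$ (where $e=v_iv_j\in E(G)$) the weight $1/x_i$. Weighted matching numbers: for a graph $H$ with edge weights $w:E(H)\to\mathbb{R}^+$ and an integer $j\ge 0$, $m(H,j)=\sum_{M}\prod_{e\in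 M}w(e)$, where the sum runs over all matchings $M$ of $H$ (sets of pairwise vertex-disjoint edges) with exactly $j$ edges. By convention $m(H,0)=1$, and $m(H,j)=0$ if $j<0$ or $j>\lfloor |V(H)|/2\rfloor$. $2$-regular subgraphs: $\mathcal C(G)$ is the set of all nonempty $2$-regular subgraphs of $G$, equivalently all nonempty disjoint unions of cycles in $G$ (subgraphs, not necessarily induced). For $C\in\mathcal C(G)$, $p(C)$ is the number of cycles of $C$, and $|C|:=|V(C)|=|E(C)|$. Deletion: for a subgraph $H'$ of a graph $H$, $H-H'$ is obtained from $H$ by deleting all vertices of $H'$ together with their incident edges. $S(C)$ is the subdivision graph of $C$, viewed as the subgraph of $S(G)$ with vertex set $V(C)\cup\{e^*\mid e\in E(C)\}$; $S(G)^{\omega^\ast}-S(C)$ keeps the weights of $S(G)^{\omega^\ast}$ on the remaining edges. The product $\prod_{v_i\notin V(C)}x_i$ runs over all $v_i\in V(G)\setminus V(C)$ (an empty product equals $1$). *)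

theory Defs
  imports Complex_Main
begin

type_synonym 'a ugraph = "'a set \<times> 'a set set"

abbreviation vertices :: "'a ugraph \<Rightarrow> 'a set" where
  "vertices G \<equiv> fst G"

abbreviation edges :: "'a ugraph \<Rightarrow> 'a set set" where
  "edges G \<equiv> snd G"

definition simple_graph :: "'a ugraph \<Rightarrow> bool" where
  "simple_graph G \<longleftrightarrow> finite (vertices G) \<and> (\<forall>e\<in>edges G. e \<subseteq> vertices G \<and> card e = 2)"

definition subgraph_of :: "'a ugraph \<Rightarrow> 'a ugraph \<Rightarrow> bool" where
  "subgraph_of H G \<longleftrightarrow> simple_graph H \<and> vertices H \<subseteq> vertices G \<and> edges H \<subseteq> edges G"

definition neighbours :: "'a ugraph \<Rightarrow> 'a \<Rightarrow> 'a set" where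
  "neighbours G u = {w. {u, w} \<in> edges G}"

definition vertex_degree :: "'a ugraph \<Rightarrow> 'a \<Rightarrow> nat" where
  "vertex_degree G u = card {e \<in> edges G. u \<in> e}"

text \<open>The graph without vertices does not count as connected.\<close>

definition connected_graph :: "'a ugraph \<Rightarrow> bool" where
  "connected_graph G \<longleftrightarrow> simple_graph G \<and> vertices G \<noteq> {} \<and>
     (\<forall>u\<in>vertices G. \<forall>w\<in>vertices G. (u, w) \<in> {(a, b). {a, b} \<in> edges G}\<^sup>*)"

definition cycle_graph :: "'a ugraph \<Rightarrow> bool" where
  "cycle_graph C \<longleftrightarrow> (\<exists>xs. 3 \<le> length xs \<and> distinct xs \<and> vertices C = set xs \<and>
     edges C = {{xs ! i, xs ! (Suc i mod length xs)} | i. i < length xs})"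

definition tree_graph :: "'a ugraph \<Rightarrow> bool" where
  "tree_graph T \<longleftrightarrow> connected_graph T \<and> (\<nexists>C. subgraph_of C T \<and> cycle_graph C)"

definition num_spanning_trees :: "'a ugraph \<Rightarrow> nat" where
  "num_spanning_trees G =
     card {T. subgraph_of T G \<and> vertices T = vertices G \<and> tree_graph T}"

text \<open>
  Every edge is a unit resistor, so by Ohm's law the current from \<open>w\<close> to a neighbour
  \<open>z\<close> is \<open>\<phi> w - \<phi> z\<close>. Kirchhoff's current law says that the net
  current leaving \<open>w\<close> is the external one: a unit enters at \<open>u\<close> and leaves at
  \<open>v\<close>. The effective resistance is the resulting potential difference. In a connected
  graph \<open>\<phi>\<close> exists and is unique up to an additive constant, so the definite
  description denotes; for \<open>u = v\<close> it is 0.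
\<close>

definition unit_current_potential :: "'a ugraph \<Rightarrow> 'a \<Rightarrow> 'a \<Rightarrow> ('a \<Rightarrow> real) \<Rightarrow> bool" where
  "unit_current_potential G u v \<phi> \<longleftrightarrow>
     (\<forall>w\<in>vertices G. (\<Sum>z\<in>neighbours G w. \<phi> w - \<phi> z) = of_bool (w = u) - of_bool (w = v))"

definition resistance_distance :: "'a ugraph \<Rightarrow> 'a \<Rightarrow> 'a \<Rightarrow> real" where
  "resistance_distance G u v = (THE r. \<exists>\<phi>. unit_current_potential G u v \<phi> \<and> r = \<phi> u - \<phi> v)"

text \<open>
  For a graph with vertices \<open>v 1, \<dots>, v n\<close> of weights \<open>x 1, \<dots>, x n\<close>.
\<close>

definition weighted_kirchhoff_index ::
  "'a ugraph \<Rightarrow> nat \<Rightarrow> (nat \<Rightarrow> 'a) \<Rightarrow> (nat \<Rightarrow> real) \<Rightarrow> real" where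
  "weighted_kirchhoff_index G n v x =
     (\<Sum>(i, j) \<in> {(i, j). 1 \<le> i \<and> i < j \<and> j \<le> n}. x i * x j * resistance_distance G (v i) (v j))"

text \<open>
  The subdivision graph keeps an old vertex \<open>u\<close> as \<open>Inl u\<close>; the vertex
  inserted into the edge \<open>e\<close> is \<open>Inr e\<close>. Hence the subdivision of a subgraph is
  literally a subgraph of the subdivision.
\<close>

definition subdivision_graph :: "'a ugraph \<Rightarrow> ('a + 'a set) ugraph" where
  "subdivision_graph G =
     (Inl ` vertices G \<union> Inr ` edges G, {{Inl u, Inr e} | u e. e \<in> edges G \<and> u \<in> e})"

text \<open>The edge \<open>{Inl u, Inr e}\<close> gets weight \<open>1 / \<omega> u\<close>.\<close>

definition subdivision_weight :: "('a \<Rightarrow> real) \<Rightarrow> ('a + 'a set) set \<Rightarrow> real" where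
  "subdivision_weight \<omega> f = 1 / \<omega> (THE u. Inl u \<in> f)"

definition graph_matching :: "'a ugraph \<Rightarrow> 'a set set \<Rightarrow> bool" where
  "graph_matching H M \<longleftrightarrow> M \<subseteq> edges H \<and> pairwise disjnt M"

text \<open>The size \<open>j\<close> is an integer, and the sum is empty for negative \<open>j\<close>.\<close>

definition weighted_matching_number :: "'a ugraph \<Rightarrow> ('a set \<Rightarrow> real) \<Rightarrow> int \<Rightarrow> real" where
  "weighted_matching_number H w j =
     (\<Sum>M | graph_matching H M \<and> int (card M) = j. \<Prod>e\<in>M. w e)"

definition delete_subgraph :: "'a ugraph \<Rightarrow> 'a ugraph \<Rightarrow> 'a ugraph" where
  "delete_subgraph H H' =
     (vertices H - vertices H', {e \<in> edges H. e \<inter> vertices H' = {}})"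

definition two_regular_subgraphs :: "'a ugraph \<Rightarrow> 'a ugraph set" where
  "two_regular_subgraphs G =
     {C. subgraph_of C G \<and> vertices C \<noteq> {} \<and> (\<forall>u\<in>vertices C. vertex_degree C u = 2)}"

definition num_cycles :: "'a ugraph \<Rightarrow> nat" where
  "num_cycles C = card {D. subgraph_of D C \<and> cycle_graph D}"

end

theory Submission
  imports Defs "HOL-Library.FuncSet"
begin

text \<open>
  The bridge between both sides is the number of forests rooted at two vertices. For a set
  \<open>S\<close> of vertices let \<open>F(S)\<close> be the number of functions sending each vertex of \<open>S\<close> to one of
  its neighbours such that iteration always leaves \<open>S\<close>, that is, of spanning forests
  with one tree for each vertex outside \<open>S\<close>, directed towards these roots. (This is also the
  principal minor of the Laplacian with rows and columns in \<open>S\<close>; here everything is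
  done by counting, without determinants.)

  Resistances are quotients of forest numbers. Counting, among the forests with roots \<open>i\<close> and
  \<open>j\<close>, those in which \<open>w\<close> lies in the tree of \<open>i\<close> gives a function of \<open>w\<close> that is harmonic away
  from \<open>i\<close> and \<open>j\<close> (\<open>forests_reaching_harmonic\<close>), because exchanging the arc leaving \<open>w\<close> pairs off
  the contributions. At \<open>i\<close> and at \<open>j\<close> the net current counts forests with a single root, that
  is, spanning trees. Hence
  \<open>r(i, j) = F(V - {i, j}) / \<tau>(G)\<close> (\<open>resistance_distance_eq_forests\<close> and
  \<open>card_rooted_forests_eq_num_spanning_trees\<close>), so that \<open>\<tau>(G)\<close> times the weighted Kirchhoff
  index is the sum over all \<open>S\<close> with two vertices left out of \<open>F(S)\<close> times the weights of the
  vertices left out.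

  Forest numbers are alternating sums of matching numbers. Call a function that sends the vertices
  of \<open>S\<close> to neighbours an edge choice if distinct vertices \<open>u\<close> use distinct edges \<open>{u, g u}\<close>, that
  is, if \<open>g\<close> has no directed 2-cycle; as a set of pairs of a vertex and an edge it is a matching of
  the subdivision graph. All directed cycles of an edge choice are
  genuine cycles of \<open>G\<close>, and inclusion-exclusion over them expresses acyclicity:
  \<open>F(S)\<close> is the sum over the 2-regular subgraphs \<open>C\<close> inside \<open>S\<close>, the empty one
  included, of \<open>(-1)\<close> to the number \<open>p(C)\<close> of cycles, times the number of edge choices on \<open>S\<close> that
  traverse every cycle of \<open>C\<close>. Each cycle can be traversed in two directions, and outside \<open>C\<close> the
  edge choice is arbitrary, which gives
  \<open>(-2)^p(C)\<close> times the number of edge choices on \<open>S - V(C)\<close> (\<open>card_rooted_forests_expansion\<close>).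
  Summed over \<open>S\<close> with weights, these edge choices are the weighted matchings of
  the subdivision graph with \<open>S(C)\<close> removed
  (\<open>weighted_matching_number_delete_subdivision\<close>).
\<close>

section \<open>Forests directed towards their roots\<close>

lemma neighbours_subset: "simple_graph G \<Longrightarrow> neighbours G u \<subseteq> vertices G"
  unfolding neighbours_def simple_graph_def by auto

lemma finite_neighbours: "simple_graph G \<Longrightarrow> finite (neighbours G u)"
  using neighbours_subset finite_subset unfolding simple_graph_def by metis

lemma finite_edges: "simple_graph G \<Longrightarrow> finite (edges G)"
  unfolding simple_graph_def by (metis Pow_iff finite_Pow_iff finite_subset subsetI)

definition arcs :: "'a set \<Rightarrow> ('a \<Rightarrow> 'a) \<Rightarrow> ('a \<times> 'a) set" where
  "arcs S g = (\<lambda>u. (u, g u)) ` S"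

text \<open>
  The values outside \<open>S\<close> are fixed, so these functions correspond one to one to the forests
  whose trees are directed towards the roots, the vertices outside \<open>S\<close>.
\<close>

definition rooted_forests :: "'a ugraph \<Rightarrow> 'a set \<Rightarrow> ('a \<Rightarrow> 'a) set" where
  "rooted_forests G S = {g \<in> PiE S (neighbours G). acyclic (arcs S g)}"

lemma arcs_insert: "w \<notin> S \<Longrightarrow> arcs (insert w S) (g(w := z)) = insert (w, z) (arcs S g)"
  unfolding arcs_def by (auto simp: image_iff)

lemma finite_rooted_forests:
  assumes "simple_graph G" "finite S"
  shows "finite (rooted_forests G S)"
proof -
  have "finite (PiE S (neighbours G))"
    using assms by (intro finite_PiE finite_neighbours)
  then show ?thesis unfolding rooted_forests_def by auto
qed

lemma single_valued_arcs: "single_valued (arcs S g)"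
  unfolding arcs_def single_valued_def by auto

lemma arcs_rtrancl_root: "w \<notin> S \<Longrightarrow> (w, z) \<in> (arcs S g)\<^sup>* \<longleftrightarrow> z = w"
  by (auto elim: converse_rtranclE simp: arcs_def)

lemma root_unique:
  assumes "(w, a) \<in> (arcs S g)\<^sup>*" "(w, b) \<in> (arcs S g)\<^sup>*" "a \<notin> S" "b \<notin> S"
  shows "a = b"
  using single_valued_confluent[OF single_valued_arcs assms(1,2)] assms(3,4)
  by (auto simp: arcs_rtrancl_root)

lemma root_exists:
  assumes "finite S" "acyclic (arcs S g)" "\<And>u. u \<in> S \<Longrightarrow> g u \<in> V" "w \<in> V"
  shows "\<exists>r\<in>V - S. (w, r) \<in> (arcs S g)\<^sup>*"
proof -
  \<comment> \<open>A finite acyclic relation cannot be followed forever.\<close>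
  have "wf ((arcs S g)\<inverse>)"
    using assms by (intro finite_acyclic_wf_converse) (auto simp: arcs_def)
  then show ?thesis using assms(4)
  proof (induction w rule: wf_induct_rule)
    case (less w)
    show ?case
    proof (cases "w \<in> S")
      case True
      then have "(w, g w) \<in> arcs S g" by (auto simp: arcs_def)
      then show ?thesis using less.IH[of "g w"] assms(3)[OF True]
        by (auto intro: converse_rtrancl_into_rtrancl)
    qed (use less.prems in auto)
  qed
qed

text \<open>
  Removing the arc that leaves \<open>w\<close> turns \<open>w\<close> into a root. Conversely, an arc from the root \<open>w\<close> to
  a neighbour \<open>z\<close> can be added unless \<open>z\<close> already lies in the tree of \<open>w\<close>, since this is the only way
  to close a directed cycle.
\<close>

lemma sum_rooted_forests_insert:
  fixes h :: "('a \<Rightarrow> 'a) \<Rightarrow> 'b :: comm_monoid_add"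
  assumes "simple_graph G" "finite S" "w \<notin> S"
  shows "(\<Sum>f\<in>rooted_forests G (insert w S). h f) =
    (\<Sum>g\<in>rooted_forests G S. \<Sum>z | z \<in> neighbours G w \<and> (z, w) \<notin> (arcs S g)\<^sup>*. h (g(w := z)))"
proof -
  define Q where
    "Q = (SIGMA g:rooted_forests G S. {z \<in> neighbours G w. (z, w) \<notin> (arcs S g)\<^sup>*})"
  have inj: "inj_on (\<lambda>(g, z). g(w := z)) Q"
  proof -
    have "inj_on ((\<lambda>(y, g). g(w := y)) \<circ> prod.swap) Q"
      using inj_combinator[OF assms(3), of "neighbours G"]
      by (intro comp_inj_on) (auto simp: Q_def rooted_forests_def inj_on_def)
    then show ?thesis by (simp add: o_def case_prod_unfold)
  qed
  have img: "rooted_forests G (insert w S) = (\<lambda>(g, z). g(w := z)) ` Q"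
    unfolding rooted_forests_def PiE_insert_eq Q_def
    using assms(3) by (auto simp: arcs_insert acyclic_insert image_iff)
  have "(\<Sum>f\<in>rooted_forests G (insert w S). h f) = (\<Sum>(g, z)\<in>Q. h (g(w := z)))"
    unfolding img sum.reindex[OF inj] by (simp add: case_prod_unfold)
  also have "\<dots> = (\<Sum>g\<in>rooted_forests G S. \<Sum>z | z \<in> neighbours G w \<and> (z, w) \<notin> (arcs S g)\<^sup>*. h (g(w := z)))"
    unfolding Q_def using assms
    by (subst sum.Sigma) (auto simp: finite_rooted_forests finite_neighbours)
  finally show ?thesis .
qed

lemma card_rooted_forests_insert:
  assumes "simple_graph G" "finite S" "w \<notin> S"
  shows "real (card (rooted_forests G (insert w S))) =
    (\<Sum>z\<in>neighbours G w. \<Sum>g\<in>rooted_forests G S. of_bool ((z, w) \<notin> (arcs S g)\<^sup>*))"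
proof -
  have "real (card (rooted_forests G (insert w S))) =
      (\<Sum>g\<in>rooted_forests G S. \<Sum>z | z \<in> neighbours G w \<and> (z, w) \<notin> (arcs S g)\<^sup>*. 1)"
    using sum_rooted_forests_insert[OF assms, of "\<lambda>_. 1 :: real"] by simp
  also have "\<dots> = (\<Sum>g\<in>rooted_forests G S. \<Sum>z\<in>neighbours G w. of_bool ((z, w) \<notin> (arcs S g)\<^sup>*))"
    using finite_neighbours[OF assms(1)]
    by (intro sum.cong refl sum.mono_neutral_cong_left) auto
  finally show ?thesis by (subst sum.swap)
qed

section \<open>Effective resistance\<close>

definition forests_reaching :: "'a ugraph \<Rightarrow> 'a set \<Rightarrow> 'a \<Rightarrow> 'a \<Rightarrow> real" where
  "forests_reaching G S i w = (\<Sum>g\<in>rooted_forests G S. of_bool ((w, i) \<in> (arcs S g)\<^sup>*))"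

text \<open>
  Take the forests without their arc leaving \<open>w\<close>, so that \<open>w\<close> is a root, and for one of them let
  \<open>p z\<close> and \<open>q z\<close> indicate whether \<open>z\<close> lies in the tree of \<open>i\<close> or of \<open>w\<close>. The arc from \<open>w\<close> may
  be put back towards each neighbour \<open>y\<close> with \<open>q y = 0\<close>; then \<open>w\<close> reaches \<open>i\<close> if \<open>p y = 1\<close>, and \<open>z\<close>
  reaches \<open>i\<close> if \<open>p z + q z * p y = 1\<close>. The difference of these indicators, summed over the
  neighbours \<open>y\<close> and \<open>z\<close>, is antisymmetric in \<open>y\<close> and \<open>z\<close> and therefore vanishes.
\<close>

lemma forests_reaching_harmonic:
  assumes "simple_graph G" "finite S" "w \<in> S" "i \<notin> S"
  shows "(\<Sum>z\<in>neighbours G w. forests_reaching G S i w - forests_reaching G S i z) = 0"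
proof -
  define S' where "S' = S - {w}"
  have S': "S = insert w S'" "w \<notin> S'" "finite S'" "i \<notin> S'" "i \<noteq> w"
    using assms by (auto simp: S'_def)
  let ?N = "neighbours G w"
  have finN: "finite ?N" using finite_neighbours[OF assms(1)] .
  have inner: "(\<Sum>y | y \<in> ?N \<and> (y, w) \<notin> (arcs S' g)\<^sup>*.
      \<Sum>z\<in>?N. of_bool ((w, i) \<in> (arcs S (g(w := y)))\<^sup>*) - of_bool ((z, i) \<in> (arcs S (g(w := y)))\<^sup>*))
      = (0 :: real)" for g
  proof -
    let ?r = "arcs S' g"
    define p q :: "'a \<Rightarrow> real" where
      "p z = of_bool ((z, i) \<in> ?r\<^sup>*)" and "q z = of_bool ((z, w) \<in> ?r\<^sup>*)" for z
    have pq: "p z * q z = 0" for z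
      using root_unique[of z i S' g w] S' by (auto simp: p_def q_def)
    have a: "(z, i) \<in> (arcs S (g(w := y)))\<^sup>* \<longleftrightarrow> (z, i) \<in> ?r\<^sup>* \<or> (z, w) \<in> ?r\<^sup>* \<and> (y, i) \<in> ?r\<^sup>*" for z y
      unfolding S'(1) arcs_insert[OF S'(2)] by (auto simp: rtrancl_insert)
    have b: "of_bool ((z, i) \<in> (arcs S (g(w := y)))\<^sup>*) = p z + q z * p y" for z y
      unfolding a using pq[of z] by (auto simp: p_def q_def)
    have c: "of_bool ((w, i) \<in> (arcs S (g(w := y)))\<^sup>*) = p y" for y
      unfolding b using S' arcs_rtrancl_root[of w S' i g] by (simp add: p_def q_def)
    have "(\<Sum>y | y \<in> ?N \<and> (y, w) \<notin> ?r\<^sup>*. \<Sum>z\<in>?N. p y - (p z + q z * p y))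
        = (\<Sum>y\<in>?N. \<Sum>z\<in>?N. (1 - q y) * (p y - (p z + q z * p y)))"
      by (rule sum.mono_neutral_cong_left) (use finN in \<open>auto simp: q_def\<close>)
    also have "\<dots> = (\<Sum>y\<in>?N. \<Sum>z\<in>?N. (p y + q y * p z) - (p z + q z * p y))"
    proof (intro sum.cong refl)
      fix y z
      show "(1 - q y) * (p y - (p z + q z * p y)) = (p y + q y * p z) - (p z + q z * p y)"
        using pq[of y] by algebra
    qed
    also have "\<dots> = 0"
      by (simp only: sum_subtractf) (subst sum.swap, simp)
    finally show ?thesis unfolding c unfolding b .
  qed
  have "(\<Sum>z\<in>?N. forests_reaching G S i w - forests_reaching G S i z) =
     (\<Sum>f\<in>rooted_forests G S. \<Sum>z\<in>?N. of_bool ((w, i) \<in> (arcs S f)\<^sup>*) - of_bool ((z, i) \<in> (arcs S f)\<^sup>*))"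
    unfolding forests_reaching_def sum_subtractf[symmetric] by (subst sum.swap) simp
  also have "\<dots> = 0"
    unfolding S'(1) sum_rooted_forests_insert[OF assms(1) S'(3,2)]
    unfolding S'(1)[symmetric] using inner by simp
  finally show ?thesis .
qed

text \<open>
  The difference of two potentials is harmonic everywhere. By the maximum principle the set
  where it is maximal is closed under passing to neighbours, hence it is everything.
\<close>

lemma unit_current_potential_difference_unique:
  assumes "connected_graph G" "i \<in> vertices G" "j \<in> vertices G"
    and "unit_current_potential G i j \<phi>" "unit_current_potential G i j \<psi>"
  shows "\<phi> i - \<phi> j = \<psi> i - \<psi> j"
proof -
  define h where "h w = \<phi> w - \<psi> w" for w
  have sg: "simple_graph G" and finV: "finite (vertices G)" and ne: "vertices G \<noteq> {}"
    using assms(1) by (auto simp: connected_graph_def simple_graph_def)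
  have harm: "(\<Sum>z\<in>neighbours G w. h w - h z) = 0" if "w \<in> vertices G" for w
  proof -
    have "(\<Sum>z\<in>neighbours G w. h w - h z) =
        (\<Sum>z\<in>neighbours G w. (\<phi> w - \<phi> z) - (\<psi> w - \<psi> z))"
      by (intro sum.cong) (auto simp: h_def)
    also have "\<dots> = 0"
      using assms(4,5) that unfolding unit_current_potential_def by (simp add: sum_subtractf)
    finally show ?thesis .
  qed
  obtain m where m: "m \<in> vertices G" "\<And>w. w \<in> vertices G \<Longrightarrow> h w \<le> h m"
  proof -
    have "Max (h ` vertices G) \<in> h ` vertices G" using finV ne by simp
    then obtain m where "m \<in> vertices G" "Max (h ` vertices G) = h m" by auto
    then show ?thesis using that finV by (metis Max_ge finite_imageI imageI)
  qed
  have "w \<in> vertices G \<and> h w = h m" if "(m, w) \<in> {(a, b). {a, b} \<in> edges G}\<^sup>*" for w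
    using that
  proof (induction rule: rtrancl_induct)
    case base
    then show ?case using m by simp
  next
    case (step y z)
    have z: "z \<in> neighbours G y" using step.hyps by (simp add: neighbours_def)
    have "\<forall>t\<in>neighbours G y. h y - h t = 0"
    proof (subst sum_nonneg_eq_0_iff[symmetric])
      show "0 \<le> h y - h t" if "t \<in> neighbours G y" for t
        using that step.IH m(2)[of t] neighbours_subset[OF sg, of y] by auto
    qed (use harm[of y] step.IH finite_neighbours[OF sg] in auto)
    then show ?case using z step.IH neighbours_subset[OF sg, of y] by auto
  qed
  then have "h i = h m" "h j = h m"
    using assms(1-3) m(1) unfolding connected_graph_def by blast+
  then show ?thesis by (simp add: h_def)
qed

lemma resistance_distance_eq:
  assumes "connected_graph G" "i \<in> vertices G" "j \<in> vertices G" "unit_current_potential G i j \<phi>"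
  shows "resistance_distance G i j = \<phi> i - \<phi> j"
  unfolding resistance_distance_def
  using unit_current_potential_difference_unique[OF assms(1-3)] assms(4) by (intro the_equality) blast+

text \<open>
  The potential at \<open>w\<close> is the fraction of forests in which \<open>w\<close> is in the tree of \<open>i\<close>, relative
  to the number \<open>t\<close> of spanning trees. At \<open>i\<close> the net current counts the pairs of a
  forest and a neighbour of \<open>i\<close> outside the tree of \<open>i\<close>, hence the forests with
  single root \<open>j\<close>; at \<open>j\<close> it is the same with \<open>i\<close> and \<open>j\<close> interchanged.
\<close>

lemma resistance_distance_eq_forests:
  assumes "connected_graph G" "i \<in> vertices G" "j \<in> vertices G" "i \<noteq> j"
    and card: "\<And>r. r \<in> vertices G \<Longrightarrow> card (rooted_forests G (vertices G - {r})) = t" and "t > 0"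
  shows "resistance_distance G i j = card (rooted_forests G (vertices G - {i, j})) / t"
proof -
  define S where "S = vertices G - {i, j}"
  define \<phi> where "\<phi> w = forests_reaching G S i w / real t" for w
  have sg: "simple_graph G" and finS: "finite S"
    using assms(1) by (auto simp: S_def connected_graph_def simple_graph_def)
  have ij: "i \<notin> S" "j \<notin> S" by (auto simp: S_def)
  have ins: "insert i S = vertices G - {j}" "insert j S = vertices G - {i}"
    using assms by (auto simp: S_def)
  have i: "forests_reaching G S i i = card (rooted_forests G S)"
    unfolding forests_reaching_def by simp
  have j: "forests_reaching G S i j = 0"
    unfolding forests_reaching_def using arcs_rtrancl_root[OF ij(2)] assms(4) by simp
  \<comment> \<open>At the sink the forests avoiding \<open>j\<close> have to be counted, via this dichotomy.\<close>
  have exact: "(z, i) \<in> (arcs S g)\<^sup>* \<longleftrightarrow> (z, j) \<notin> (arcs S g)\<^sup>*"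
    if "g \<in> rooted_forests G S" "z \<in> vertices G" for g z
  proof -
    have "g u \<in> vertices G" if "u \<in> S" for u
      using \<open>g \<in> _\<close> that neighbours_subset[OF sg, of u] by (auto simp: rooted_forests_def)
    then have "\<exists>r\<in>vertices G - S. (z, r) \<in> (arcs S g)\<^sup>*"
      using that finS by (intro root_exists) (auto simp: rooted_forests_def)
    moreover have "vertices G - S \<subseteq> {i, j}" by (auto simp: S_def)
    ultimately show ?thesis using root_unique[of z i S g j] ij assms(4) by blast
  qed
  have "unit_current_potential G i j \<phi>"
    unfolding unit_current_potential_def
  proof
    fix w assume w: "w \<in> vertices G"
    have red: "(\<Sum>z\<in>neighbours G w. \<phi> w - \<phi> z) =
        (\<Sum>z\<in>neighbours G w. forests_reaching G S i w - forests_reaching G S i z) / t"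
      unfolding \<phi>_def by (simp add: sum_divide_distrib diff_divide_distrib)
    consider "w = i" | "w = j" | "w \<in> S" using w by (auto simp: S_def)
    then show "(\<Sum>z\<in>neighbours G w. \<phi> w - \<phi> z) = of_bool (w = i) - of_bool (w = j)"
    proof cases
      case 1
      have "(\<Sum>z\<in>neighbours G i. forests_reaching G S i i - forests_reaching G S i z) = real t"
      proof -
        have "(\<Sum>z\<in>neighbours G i. forests_reaching G S i i - forests_reaching G S i z) =
           (\<Sum>z\<in>neighbours G i. \<Sum>g\<in>rooted_forests G S. of_bool ((z, i) \<notin> (arcs S g)\<^sup>*))"
          unfolding forests_reaching_def sum_subtractf[symmetric]
          by (intro sum.cong) auto
        then show ?thesis using card_rooted_forests_insert[OF sg finS ij(1)] ins(1) card assms(3) by simp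
      qed
      then show ?thesis unfolding red using 1 \<open>t > 0\<close> assms(4) by simp
    next
      case 2
      have "(\<Sum>z\<in>neighbours G j. forests_reaching G S i j - forests_reaching G S i z) = - real t"
      proof -
        have "(\<Sum>z\<in>neighbours G j. forests_reaching G S i j - forests_reaching G S i z) =
           - (\<Sum>z\<in>neighbours G j. forests_reaching G S i z)"
          unfolding j by (simp add: sum_negf)
        also have "(\<Sum>z\<in>neighbours G j. forests_reaching G S i z) =
           (\<Sum>z\<in>neighbours G j. \<Sum>g\<in>rooted_forests G S. of_bool ((z, j) \<notin> (arcs S g)\<^sup>*))"
          unfolding forests_reaching_def using exact neighbours_subset[OF sg, of j]
          by (intro sum.cong refl) auto
        finally show ?thesis
          using card_rooted_forests_insert[OF sg finS ij(2)] ins(2) card assms(2) by simp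
      qed
      then show ?thesis unfolding red using 2 \<open>t > 0\<close> assms(4) by simp
    next
      case 3
      then show ?thesis
        unfolding red using forests_reaching_harmonic[OF sg finS 3 ij(1)] ij by auto
    qed
  qed
  then have "resistance_distance G i j = \<phi> i - \<phi> j"
    by (rule resistance_distance_eq[OF assms(1-3)])
  then show ?thesis unfolding \<phi>_def i j by (simp add: S_def)
qed

section \<open>Cycles and 2-regular graphs\<close>

definition arc_edges :: "'a set \<Rightarrow> ('a \<Rightarrow> 'a) \<Rightarrow> 'a set set" where
  "arc_edges S g = (\<lambda>u. {u, g u}) ` S"

definition cycle_of :: "'a list \<Rightarrow> 'a ugraph" where
  "cycle_of xs = (set xs, {{xs ! i, xs ! (Suc i mod length xs)} | i. i < length xs})"

lemma cycle_graph_iff: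
  "cycle_graph D \<longleftrightarrow> (\<exists>xs. 3 \<le> length xs \<and> distinct xs \<and> D = cycle_of xs)"
  unfolding cycle_graph_def cycle_of_def by (auto simp: prod_eq_iff)

text \<open>
  When the next vertex already occurs on the path, the loop it closes is cut off.
\<close>

lemma rtrancl_imp_distinct_path:
  assumes "(a, b) \<in> r\<^sup>*"
  shows "\<exists>xs. xs \<noteq> [] \<and> hd xs = a \<and> last xs = b \<and> distinct xs \<and>
           successively (\<lambda>x y. (x, y) \<in> r) xs"
  using assms
proof (induction rule: converse_rtrancl_induct)
  case base
  show ?case by (intro exI[of _ "[b]"]) auto
next
  case (step y z)
  then obtain xs where xs: "xs \<noteq> []" "hd xs = z" "last xs = b" "distinct xs"
    "successively (\<lambda>x y. (x, y) \<in> r) xs" by blast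
  show ?case
  proof (cases "y \<in> set xs")
    case True
    then obtain ps qs where "xs = ps @ y # qs" by (auto simp: in_set_conv_decomp)
    then show ?thesis using xs
      by (intro exI[of _ "y # qs"]) (auto simp: successively_append_iff)
  next
    case False
    then show ?thesis using xs step.hyps
      by (intro exI[of _ "y # xs"]) (auto simp: successively_Cons)
  qed
qed

lemma edges_cycle_of_cases:
  assumes "e \<in> edges (cycle_of xs)"
  obtains i where "Suc i < length xs" "e = {xs ! i, xs ! Suc i}"
    | "xs \<noteq> []" "e = {last xs, hd xs}"
proof -
  from assms obtain i where i: "i < length xs" "e = {xs ! i, xs ! (Suc i mod length xs)}"
    by (auto simp: cycle_of_def)
  show ?thesis
  proof (cases "Suc i < length xs")
    case True
    then show ?thesis using i that(1) by simp
  next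
    case False
    then have "i = length xs - 1" "xs \<noteq> []" using i by auto
    then show ?thesis using i that(2) by (auto simp: last_conv_nth hd_conv_nth)
  qed
qed

lemma edges_cycle_of_subset:
  assumes "successively (\<lambda>x y. {x, y} \<in> E) xs" "{last xs, hd xs} \<in> E"
  shows "edges (cycle_of xs) \<subseteq> E"
proof
  fix e assume "e \<in> edges (cycle_of xs)"
  then show "e \<in> E"
    using assms by (cases rule: edges_cycle_of_cases) (auto simp: successively_conv_nth)
qed

text \<open>
  \<open>\<sigma>\<close> runs once around the cycle \<open>D\<close>. The last conjunct says that it has a single orbit: a set
  closed under \<open>\<sigma>\<close> that meets the cycle contains it. In this form, arguments about cycles
  need no arithmetic of positions in a list.
\<close>

definition cyclic_rotation :: "'a ugraph \<Rightarrow> ('a \<Rightarrow> 'a) \<Rightarrow> bool" where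
  "cyclic_rotation D \<sigma> \<longleftrightarrow>
     finite (vertices D) \<and> vertices D \<noteq> {} \<and>
     bij_betw \<sigma> (vertices D) (vertices D) \<and> edges D = arc_edges (vertices D) \<sigma> \<and>
     (\<forall>u\<in>vertices D. \<sigma> u \<noteq> u \<and> \<sigma> (\<sigma> u) \<noteq> u) \<and>
     (\<forall>Y. Y \<inter> vertices D \<noteq> {} \<longrightarrow> (\<forall>u\<in>Y \<inter> vertices D. \<sigma> u \<in> Y) \<longrightarrow> vertices D \<subseteq> Y)"

lemma cyclic_rotation_cycle_of:
  assumes xs: "3 \<le> length xs" "distinct xs"
    and step: "\<And>i. i < length xs \<Longrightarrow> \<sigma> (xs ! i) = xs ! (Suc i mod length xs)"
  shows "cyclic_rotation (cycle_of xs) \<sigma>"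
proof -
  define D where "D = cycle_of xs"
  define k where "k = length xs"
  have V: "vertices D = set xs" and E: "edges D = {{xs ! i, xs ! (Suc i mod k)} | i. i < k}"
    by (auto simp: D_def cycle_of_def k_def)
  have imV: "set xs = (!) xs ` {..<k}" by (auto simp: k_def set_conv_nth)
  have \<sigma>: "\<sigma> (xs ! i) = xs ! (Suc i mod k)" if "i < k" for i
    using step that by (simp add: k_def)
  have inV: "\<exists>i<k. u = xs ! i" if "u \<in> set xs" for u
    using that by (metis in_set_conv_nth k_def)
  have k3: "3 \<le> k" using xs by (simp add: k_def)
  have eq: "xs ! i = xs ! j \<longleftrightarrow> i = j" if "i < k" "j < k" for i j
    using that xs(2) by (simp add: k_def nth_eq_iff_index_eq)
  have "cyclic_rotation D \<sigma>"
    unfolding cyclic_rotation_def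
  proof (intro conjI ballI allI impI)
    have "\<sigma> ` set xs \<subseteq> set xs"
      using k3 \<sigma> unfolding imV by (auto intro!: imageI)
    moreover have "inj_on \<sigma> (set xs)"
    proof (rule inj_onI)
      fix u w assume uw: "u \<in> set xs" "w \<in> set xs" "\<sigma> u = \<sigma> w"
      then obtain i j where ij: "i < k" "u = xs ! i" "j < k" "w = xs ! j" using inV by meson
      then have "Suc i mod k = Suc j mod k"
        using uw \<sigma> eq[of "Suc i mod k" "Suc j mod k"] k3 by simp
      then have "i = j" using ij by (auto simp: mod_Suc split: if_splits)
      then show "u = w" using ij by simp
    qed
    ultimately show "bij_betw \<sigma> (vertices D) (vertices D)"
      unfolding V by (simp add: bij_betw_def endo_inj_surj)
    show "edges D = arc_edges (vertices D) \<sigma>"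
    proof -
      have "arc_edges (vertices D) \<sigma> = (\<lambda>u. {u, \<sigma> u}) ` ((!) xs ` {..<k})"
        by (simp add: V imV arc_edges_def)
      also have "\<dots> = (\<lambda>i. {xs ! i, xs ! (Suc i mod k)}) ` {..<k}"
        unfolding image_image using \<sigma> by (intro image_cong) auto
      finally show ?thesis unfolding E by auto
    qed
    show "\<sigma> u \<noteq> u" if u: "u \<in> vertices D" for u
    proof -
      obtain i where i: "i < k" "u = xs ! i" using inV[of u] u unfolding V by blast
      have "Suc i mod k \<noteq> i" using i k3 by (auto simp: mod_Suc)
      then show ?thesis using i \<sigma> eq[of "Suc i mod k" i] by auto
    qed
    show "\<sigma> (\<sigma> u) \<noteq> u" if u: "u \<in> vertices D" for u
    proof -
      obtain i where i: "i < k" "u = xs ! i" using inV[of u] u unfolding V by blast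
      have "Suc (Suc i mod k) mod k \<noteq> i" using i k3 by (auto simp: mod_Suc)
      then show ?thesis using i \<sigma>[of i] \<sigma>[of "Suc i mod k"] eq[of "Suc (Suc i mod k) mod k" i] by auto
    qed
    show "vertices D \<subseteq> Y"
      if Y: "Y \<inter> vertices D \<noteq> {}" "\<forall>u\<in>Y \<inter> vertices D. \<sigma> u \<in> Y" for Y
    proof
      obtain i where i: "i < k" "xs ! i \<in> Y" using Y(1) inV V by blast
      have all: "xs ! ((i + m) mod k) \<in> Y" for m
      proof (induction m)
        case 0
        then show ?case using i by simp
      next
        case (Suc m)
        have "xs ! ((i + m) mod k) \<in> set xs"
          using k3 by (auto simp: k_def intro!: nth_mem mod_less_divisor)
        then have "\<sigma> (xs ! ((i + m) mod k)) \<in> Y"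
          using Suc.IH V Y(2) by auto
        also have "\<sigma> (xs ! ((i + m) mod k)) = xs ! ((i + Suc m) mod k)"
          using k3 by (subst \<sigma>) (auto simp: mod_simps)
        finally show ?case .
      qed
      fix u assume "u \<in> vertices D"
      then obtain j where j: "j < k" "u = xs ! j" using inV[of u] unfolding V by blast
      \<comment> \<open>From position \<open>i\<close>, after \<open>k - i\<close> steps position 0 is reached, and position \<open>j\<close> after \<open>j\<close> more.\<close>
      then show "u \<in> Y" using all[of "k - i + j"] i by simp
    qed
    show "finite (vertices D)" "vertices D \<noteq> {}" using V k3 by (auto simp: k_def)
  qed
  then show ?thesis by (simp add: D_def)
qed

lemma cycle_graph_cyclic_rotation:
  assumes "cycle_graph D"
  obtains \<sigma> where "cyclic_rotation D \<sigma>"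
proof -
  from assms obtain xs where xs: "3 \<le> length xs" "distinct xs" "D = cycle_of xs"
    unfolding cycle_graph_iff by blast
  define ix where "ix = inv_into {..<length xs} ((!) xs)"
  have "ix (xs ! i) = i" if "i < length xs" for i
    using that xs(2) unfolding ix_def by (intro inv_into_f_f inj_on_nth) auto
  then have "cyclic_rotation D (\<lambda>u. xs ! (Suc (ix u) mod length xs))"
    unfolding xs(3) using xs by (intro cyclic_rotation_cycle_of) auto
  then show ?thesis by (rule that)
qed

lemma cycle_graph_connected:
  assumes "cycle_graph D" "Y \<inter> vertices D \<noteq> {}"
    and "\<And>u w. u \<in> Y \<Longrightarrow> {u, w} \<in> edges D \<Longrightarrow> w \<in> Y"
  shows "vertices D \<subseteq> Y"
proof -
  obtain \<sigma> where \<sigma>: "cyclic_rotation D \<sigma>" by (rule cycle_graph_cyclic_rotation[OF assms(1)])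
  then have "\<forall>u\<in>Y \<inter> vertices D. \<sigma> u \<in> Y"
    using assms(3) by (auto simp: cyclic_rotation_def arc_edges_def)
  then show ?thesis using \<sigma> assms(2) by (simp add: cyclic_rotation_def)
qed

definition two_regular :: "'a ugraph \<Rightarrow> bool" where
  "two_regular C \<longleftrightarrow> simple_graph C \<and> (\<forall>u\<in>vertices C. vertex_degree C u = 2)"

lemma cycle_graph_two_regular:
  assumes "cycle_graph D"
  shows "two_regular D"
proof -
  obtain \<sigma> where \<sigma>: "cyclic_rotation D \<sigma>" by (rule cycle_graph_cyclic_rotation[OF assms])
  have bij: "bij_betw \<sigma> (vertices D) (vertices D)"
    and E: "edges D = (\<lambda>u. {u, \<sigma> u}) ` vertices D"
    and s1: "\<And>u. u \<in> vertices D \<Longrightarrow> \<sigma> u \<noteq> u" and s2: "\<And>u. u \<in> vertices D \<Longrightarrow> \<sigma> (\<sigma> u) \<noteq> u"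
    and fin: "finite (vertices D)"
    using \<sigma> by (simp_all add: cyclic_rotation_def arc_edges_def)
  have \<sigma>V: "\<sigma> u \<in> vertices D" if "u \<in> vertices D" for u
    using bij that by (auto simp: bij_betw_def)
  have "vertex_degree D u = 2" if u: "u \<in> vertices D" for u
  proof -
    obtain t where t: "t \<in> vertices D" "\<sigma> t = u" using bij u unfolding bij_betw_def by (metis imageE)
    have uniq: "t' = t" if "t' \<in> vertices D" "\<sigma> t' = u" for t'
      using bij t that by (auto simp: bij_betw_def inj_on_def)
    have "{e \<in> edges D. u \<in> e} = {{u, \<sigma> u}, {t, u}}"
    proof
      show "{e \<in> edges D. u \<in> e} \<subseteq> {{u, \<sigma> u}, {t, u}}"
      proof
        fix e assume "e \<in> {e \<in> edges D. u \<in> e}"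
        then obtain x where "x \<in> vertices D" "e = {x, \<sigma> x}" "u = x \<or> \<sigma> x = u"
          unfolding E by blast
        then show "e \<in> {{u, \<sigma> u}, {t, u}}" using uniq[of x] t(2) by auto
      qed
      show "{{u, \<sigma> u}, {t, u}} \<subseteq> {e \<in> edges D. u \<in> e}"
        unfolding E using t u by blast
    qed
    moreover have "{u, \<sigma> u} \<noteq> {t, u}"
      using s1[OF u] s2[OF t(1)] t(2) by (auto simp: doubleton_eq_iff)
    ultimately show ?thesis by (simp add: vertex_degree_def)
  qed
  moreover have "simple_graph D"
    unfolding simple_graph_def E using fin \<sigma>V s1 by (force simp: card_insert_if)
  ultimately show ?thesis by (simp add: two_regular_def)
qed

text \<open>
  Both sides have two elements. So a cycle in a 2-regular graph has no edges to the
  rest, i.e. it is a component.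
\<close>

lemma subgraph_two_regular_incident_edges:
  assumes "two_regular C" "two_regular D" "subgraph_of D C" "u \<in> vertices D"
  shows "{e \<in> edges C. u \<in> e} = {e \<in> edges D. u \<in> e}"
proof -
  have "card {e \<in> edges C. u \<in> e} = 2" "card {e \<in> edges D. u \<in> e} = 2"
    using assms unfolding two_regular_def vertex_degree_def subgraph_of_def by auto
  moreover have "{e \<in> edges D. u \<in> e} \<subseteq> {e \<in> edges C. u \<in> e}"
    using assms by (auto simp: subgraph_of_def)
  moreover have "finite {e \<in> edges C. u \<in> e}"
    using assms(1) finite_edges[of C] by (auto simp: two_regular_def)
  ultimately show ?thesis by (metis card_subset_eq)
qed

lemma subgraph_of_trans: "subgraph_of A B \<Longrightarrow> subgraph_of B C \<Longrightarrow> subgraph_of A C"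
  unfolding subgraph_of_def by blast

lemma edge_vertex: "simple_graph G \<Longrightarrow> e \<in> edges G \<Longrightarrow> u \<in> e \<Longrightarrow> u \<in> vertices G"
  unfolding simple_graph_def by auto

lemma simple_graph_edgeE:
  assumes "simple_graph G" "e \<in> edges G"
  obtains a b where "e = {a, b}" "a \<noteq> b" "a \<in> vertices G" "b \<in> vertices G"
proof -
  have "card e = 2" "e \<subseteq> vertices G" using assms by (auto simp: simple_graph_def)
  then show ?thesis using that by (auto simp: card_2_iff)
qed

lemma incident_edgeE:
  assumes "simple_graph G" "e \<in> edges G" "u \<in> e"
  obtains w where "e = {u, w}" "w \<noteq> u"
  by (rule simple_graph_edgeE[OF assms(1,2)]) (use assms(3) that in auto)

text \<open>
  Removing a cycle from a 2-regular graph leaves a 2-regular graph with one cycle less; this is what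
  inductions over the number of cycles, and the sign reversal below, rely on.
\<close>

context
  fixes C D :: "'a ugraph"
  assumes C: "two_regular C" and D: "cycle_graph D" and DC: "subgraph_of D C"
begin

lemma cycle_closed:
  assumes "e \<in> edges C" "e \<inter> vertices D \<noteq> {}"
  shows "e \<in> edges D" "e \<subseteq> vertices D"
proof -
  obtain u where "u \<in> e" "u \<in> vertices D" using assms by blast
  then show "e \<in> edges D"
    using subgraph_two_regular_incident_edges[OF C cycle_graph_two_regular[OF D] DC] assms by blast
  then show "e \<subseteq> vertices D" using DC by (auto simp: subgraph_of_def simple_graph_def)
qed

lemma delete_cycle_vertices: "vertices C = vertices (delete_subgraph C D) \<union> vertices D"
  using DC by (auto simp: delete_subgraph_def subgraph_of_def)

lemma delete_cycle_edges: "edges C = edges (delete_subgraph C D) \<union> edges D"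
  using DC cycle_closed by (fastforce simp: delete_subgraph_def subgraph_of_def)

lemma delete_cycle_subgraph: "subgraph_of (delete_subgraph C D) C"
proof -
  have "simple_graph C" using C by (simp add: two_regular_def)
  then show ?thesis
    by (fastforce simp: subgraph_of_def delete_subgraph_def simple_graph_def)
qed

lemma delete_cycle_two_regular: "two_regular (delete_subgraph C D)"
  unfolding two_regular_def
proof (intro conjI ballI)
  show "simple_graph (delete_subgraph C D)"
    using delete_cycle_subgraph by (simp add: subgraph_of_def)
  fix u assume u: "u \<in> vertices (delete_subgraph C D)"
  then have "{e \<in> edges (delete_subgraph C D). u \<in> e} = {e \<in> edges C. u \<in> e}"
    using cycle_closed(2) by (fastforce simp: delete_subgraph_def)
  then show "vertex_degree (delete_subgraph C D) u = 2"
    using C u by (simp add: vertex_degree_def two_regular_def delete_subgraph_def)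
qed

lemma cycle_disjoint_or_equal:
  assumes "cycle_graph D'" "subgraph_of D' C" "vertices D' \<inter> vertices D \<noteq> {}"
  shows "D' = D"
proof -
  have sub: "vertices A \<subseteq> vertices B"
    if "cycle_graph A" "subgraph_of A C" "cycle_graph B" "subgraph_of B C"
      "vertices A \<inter> vertices B \<noteq> {}" for A B
  proof (rule cycle_graph_connected[OF that(1)])
    show "vertices B \<inter> vertices A \<noteq> {}" using that by blast
    fix u w assume uw: "u \<in> vertices B" "{u, w} \<in> edges A"
    then have "{u, w} \<in> {e \<in> edges C. u \<in> e}" using that by (auto simp: subgraph_of_def)
    then have "{u, w} \<in> edges B"
      using subgraph_two_regular_incident_edges[OF C cycle_graph_two_regular[OF that(3)] that(4) uw(1)]
      by blast
    then show "w \<in> vertices B" using that(4) by (auto simp: subgraph_of_def simple_graph_def)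
  qed
  have V: "vertices D' = vertices D"
    using sub[OF assms(1,2) D DC] sub[OF D DC assms(1,2)] assms(3) by blast
  have "edges A \<subseteq> edges B" if AC: "subgraph_of A C" and "cycle_graph B" "subgraph_of B C" "vertices A = vertices B" for A B
  proof
    fix e assume e: "e \<in> edges A"
    then obtain u where u: "u \<in> e" "u \<in> vertices A"
      using AC unfolding subgraph_of_def by (blast elim: simple_graph_edgeE)
    then show "e \<in> edges B"
      using subgraph_two_regular_incident_edges[OF C cycle_graph_two_regular[OF that(2)] that(3), of u] AC that(4) e
      by (auto simp: subgraph_of_def)
  qed
  then have "edges D' = edges D" using V assms D DC by (metis subset_antisym)
  then show ?thesis using V by (simp add: prod_eq_iff)
qed

lemma num_cycles_delete_cycle: "num_cycles C = Suc (num_cycles (delete_subgraph C D))"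
proof -
  let ?C' = "delete_subgraph C D"
  have simC: "simple_graph C" using C by (simp add: two_regular_def)
  have Dne: "vertices D \<noteq> {}" using D by (auto simp: cycle_graph_def)
  have fin: "finite {F. subgraph_of F C \<and> cycle_graph F}"
  proof (rule finite_subset)
    show "{F. subgraph_of F C \<and> cycle_graph F} \<subseteq> Pow (vertices C) \<times> Pow (edges C)"
      by (auto simp: subgraph_of_def)
    show "finite (Pow (vertices C) \<times> Pow (edges C))"
      using simC finite_edges[OF simC] by (auto simp: simple_graph_def)
  qed
  have eq: "{F. subgraph_of F C \<and> cycle_graph F} = insert D {F. subgraph_of F ?C' \<and> cycle_graph F}"
  proof (intro equalityI subsetI)
    fix F assume F: "F \<in> {F. subgraph_of F C \<and> cycle_graph F}"
    show "F \<in> insert D {F. subgraph_of F ?C' \<and> cycle_graph F}"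
    proof (cases "F = D")
      case False
      then have dis: "vertices F \<inter> vertices D = {}" using cycle_disjoint_or_equal F by blast
      then have "subgraph_of F ?C'"
        using F unfolding subgraph_of_def delete_subgraph_def simple_graph_def by auto
      then show ?thesis using F by simp
    qed simp
  next
    fix F assume "F \<in> insert D {F. subgraph_of F ?C' \<and> cycle_graph F}"
    then show "F \<in> {F. subgraph_of F C \<and> cycle_graph F}"
      using D DC subgraph_of_trans[OF _ delete_cycle_subgraph] by blast
  qed
  have "D \<notin> {F. subgraph_of F ?C' \<and> cycle_graph F}"
    using Dne by (auto simp: subgraph_of_def delete_subgraph_def)
  then show ?thesis using fin unfolding num_cycles_def eq by simp
qed

end

lemma two_regular_disjoint_union:
  assumes "two_regular C" "two_regular D" "vertices C \<inter> vertices D = {}"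
  shows "two_regular (vertices C \<union> vertices D, edges C \<union> edges D)"
  unfolding two_regular_def
proof (intro conjI ballI)
  have sim: "simple_graph C" "simple_graph D" using assms by (auto simp: two_regular_def)
  show "simple_graph (vertices C \<union> vertices D, edges C \<union> edges D)"
    using sim by (auto simp: simple_graph_def)
  fix u assume u: "u \<in> vertices (vertices C \<union> vertices D, edges C \<union> edges D)"
  show "vertex_degree (vertices C \<union> vertices D, edges C \<union> edges D) u = 2"
  proof (cases "u \<in> vertices C")
    case True
    then have "{e \<in> edges C \<union> edges D. u \<in> e} = {e \<in> edges C. u \<in> e}"
      using assms(3) edge_vertex[OF sim(2)] by blast
    then show ?thesis using True assms by (simp add: vertex_degree_def two_regular_def)
  next
    case False
    then have "{e \<in> edges C \<union> edges D. u \<in> e} = {e \<in> edges D. u \<in> e}"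
      using edge_vertex[OF sim(1)] by blast
    then show ?thesis using False u assms by (simp add: vertex_degree_def two_regular_def)
  qed
qed

text \<open>
  The first vertex of a longest path has two neighbours, both on the path by maximality. The one
  that is not the second vertex of the path closes a cycle.
\<close>

lemma two_regular_has_cycle:
  assumes "two_regular C" "vertices C \<noteq> {}"
  obtains D where "cycle_graph D" "subgraph_of D C"
proof -
  have sim: "simple_graph C" and finV: "finite (vertices C)"
    using assms by (auto simp: two_regular_def simple_graph_def)
  define P where "P xs \<longleftrightarrow> xs \<noteq> [] \<and> distinct xs \<and> set xs \<subseteq> vertices C \<and>
    successively (\<lambda>x y. {x, y} \<in> edges C) xs" for xs
  obtain a where "a \<in> vertices C" using assms by blast
  then have "P [a]" by (simp add: P_def)
  moreover have "\<forall>xs. P xs \<longrightarrow> length xs < Suc (card (vertices C))"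
    using finV by (auto simp: P_def distinct_card[symmetric] less_Suc_eq_le card_mono)
  ultimately obtain xs where xs: "P xs" "\<And>ys. P ys \<Longrightarrow> length ys \<le> length xs"
    using ex_has_greatest_nat[of P "[a]" length] by blast
  define u where "u = hd xs"
  have u: "u = xs ! 0" "u \<in> vertices C" using xs by (auto simp: P_def u_def hd_conv_nth)
  have nb: "w \<in> set xs" if "{u, w} \<in> edges C" for w
  proof (rule ccontr)
    assume "w \<notin> set xs"
    then have "P (w # xs)"
      using xs(1) that edge_vertex[OF sim that] by (auto simp: P_def successively_Cons u_def insert_commute)
    then show False using xs(2) by force
  qed
  obtain e f where ef: "{e \<in> edges C. u \<in> e} = {e, f}" "e \<noteq> f"
    using assms(1) u(2) unfolding two_regular_def vertex_degree_def card_2_iff by blast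
  have efC: "e \<in> edges C" "f \<in> edges C" "u \<in> e" "u \<in> f" using ef(1) by blast+
  obtain s where s: "e = {u, s}" "s \<noteq> u" by (rule incident_edgeE[OF sim efC(1,3)])
  obtain t where t: "f = {u, t}" "t \<noteq> u" by (rule incident_edgeE[OF sim efC(2,4)])
  have st: "s \<noteq> t" "{u, s} \<in> edges C" "{u, t} \<in> edges C" using ef(2) efC s t by auto
  have "\<exists>w. {u, w} \<in> edges C \<and> w \<noteq> u \<and> w \<noteq> xs ! 1" using s t st by metis
  then obtain w where w: "{u, w} \<in> edges C" "w \<noteq> u" "w \<noteq> xs ! 1" by blast
  then obtain k where k: "k < length xs" "w = xs ! k" using nb by (metis in_set_conv_nth)
  have k2: "2 \<le> k" using w k u by (cases k; cases "k - 1") auto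
  define ys where "ys = take (Suc k) xs"
  have len: "length ys = Suc k" using k by (simp add: ys_def)
  have ys: "distinct ys" "set ys \<subseteq> vertices C" "successively (\<lambda>x y. {x, y} \<in> edges C) ys"
    using xs(1) k set_take_subset[of "Suc k" xs]
    by (auto simp: ys_def P_def successively_conv_nth)
  have "ys \<noteq> []" using len by auto
  then have "last ys = w" "hd ys = u"
    using k u len by (auto simp: last_conv_nth hd_conv_nth ys_def)
  then have sub: "edges (cycle_of ys) \<subseteq> edges C"
    using ys w by (intro edges_cycle_of_subset) (auto simp: insert_commute)
  have cyc: "cycle_graph (cycle_of ys)"
    using ys k2 len unfolding cycle_graph_iff by force
  show ?thesis
  proof (rule that[OF cyc])
    show "subgraph_of (cycle_of ys) C"
      using sub cycle_graph_two_regular[OF cyc] ys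
      by (auto simp: subgraph_of_def two_regular_def cycle_of_def)
  qed
qed

section \<open>Spanning trees\<close>

lemma acyclic_imp_arc_edges_inj:
  assumes "acyclic (arcs S g)"
  shows "inj_on (\<lambda>u. {u, g u}) S"
proof (rule inj_onI, rule ccontr)
  fix u w assume uw: "u \<in> S" "w \<in> S" "{u, g u} = {w, g w}" "u \<noteq> w"
  then have "(u, w) \<in> arcs S g" "(w, u) \<in> arcs S g"
    by (auto simp: arcs_def doubleton_eq_iff)
  then have "(u, u) \<in> (arcs S g)\<^sup>+" by (meson trancl.simps)
  then show False using assms by (auto simp: acyclic_def)
qed

text \<open>
  A vertex of the cycle that no arc enters from within the cycle lies on only one of its
  edges, the one given by its own outgoing arc.
\<close>

lemma acyclic_arc_edges_no_cycle:
  assumes "finite S" "acyclic (arcs S g)" "cycle_graph D" "edges D \<subseteq> arc_edges S g"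
  shows False
proof -
  have two: "two_regular D" using assms(3) by (rule cycle_graph_two_regular)
  then have sim: "simple_graph D" by (simp add: two_regular_def)
  have "wf (arcs S g)" using assms by (intro finite_acyclic_wf) (auto simp: arcs_def)
  moreover obtain a where "a \<in> vertices D" using assms(3) by (fastforce simp: cycle_graph_def)
  ultimately obtain u where u: "u \<in> vertices D" "\<And>t. (t, u) \<in> arcs S g \<Longrightarrow> t \<notin> vertices D"
    by (metis wfE_min)
  have "{e \<in> edges D. u \<in> e} \<subseteq> {{u, g u}}"
  proof
    fix e assume e: "e \<in> {e \<in> edges D. u \<in> e}"
    then obtain t where t: "t \<in> S" "e = {t, g t}" using assms(4) by (auto simp: arc_edges_def)
    have "t \<in> vertices D" using edge_vertex[OF sim, of e t] e t by simp
    then have "(t, u) \<notin> arcs S g" using u(2) by blast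
    then have "t = u" using t e by (auto simp: arcs_def)
    then show "e \<in> {{u, g u}}" using t by simp
  qed
  then have "card {e \<in> edges D. u \<in> e} \<le> 1"
    using card_mono[of "{{u, g u}}"] by simp
  then show False using two u(1) by (simp add: two_regular_def vertex_degree_def)
qed

lemma arcs_subset_edges: "arcs S g \<subseteq> {(a, b). {a, b} \<in> arc_edges S g}"
  by (auto simp: arcs_def arc_edges_def)

lemma rooted_forest_spanning_tree:
  assumes "simple_graph G" "r \<in> vertices G" "g \<in> rooted_forests G (vertices G - {r})"
  defines "T \<equiv> (vertices G, arc_edges (vertices G - {r}) g)"
  shows "subgraph_of T G" "tree_graph T"
proof -
  let ?S = "vertices G - {r}"
  let ?R = "{(a, b). {a, b} \<in> edges T}"
  have fin: "finite ?S" using assms(1) by (simp add: simple_graph_def)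
  have gE: "{u, g u} \<in> edges G" if "u \<in> ?S" for u
    using assms(3) that by (auto simp: rooted_forests_def neighbours_def PiE_iff)
  then have gV: "g u \<in> vertices G" if "u \<in> ?S" for u
    using that assms(1) edge_vertex by (metis insertCI)
  have ET: "edges T \<subseteq> edges G" using gE by (auto simp: T_def arc_edges_def)
  then have sT: "simple_graph T" using assms(1) unfolding simple_graph_def T_def by auto
  then show "subgraph_of T G" using ET by (simp add: subgraph_of_def T_def)
  have ac: "acyclic (arcs ?S g)" using assms(3) by (simp add: rooted_forests_def)
  have reach: "(w, r) \<in> ?R\<^sup>*" if w: "w \<in> vertices G" for w
  proof -
    have "\<exists>r'\<in>vertices G - ?S. (w, r') \<in> (arcs ?S g)\<^sup>*"
      by (rule root_exists[OF fin ac gV w])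
    then have "(w, r) \<in> (arcs ?S g)\<^sup>*" by auto
    moreover have "arcs ?S g \<subseteq> ?R" using arcs_subset_edges by (simp add: T_def)
    ultimately show ?thesis using rtrancl_mono by blast
  qed
  have "sym ?R" by (auto simp: sym_def insert_commute)
  then have "sym (?R\<^sup>*)" by (rule sym_rtrancl)
  then have "(u, w) \<in> ?R\<^sup>*" if "u \<in> vertices G" "w \<in> vertices G" for u w
    using reach that by (meson symD rtrancl_trans)
  then have "connected_graph T"
    unfolding connected_graph_def using sT assms(2) by (auto simp: T_def)
  then show "tree_graph T"
    unfolding tree_graph_def using acyclic_arc_edges_no_cycle[OF fin ac]
    by (auto simp: subgraph_of_def T_def)
qed

text \<open>
  The direction of the edges can be read off from the roots upwards: once the
  arc leaving \<open>g u\<close> is known to agree, the edge \<open>{u, g u}\<close> cannot be that arc, so it is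
  the arc leaving \<open>u\<close> in both forests.
\<close>

lemma rooted_forest_determined_by_edges:
  assumes "finite S" "g \<in> rooted_forests G S" "h \<in> rooted_forests G S" "arc_edges S g = arc_edges S h"
  shows "g = h"
proof (rule PiE_ext)
  show "g \<in> PiE S (neighbours G)" "h \<in> PiE S (neighbours G)"
    using assms by (auto simp: rooted_forests_def)
  have ac: "acyclic (arcs S g)" using assms by (simp add: rooted_forests_def)
  then have wf: "wf ((arcs S g)\<inverse>)"
    using assms(1) by (intro finite_acyclic_wf_converse) (auto simp: arcs_def)
  fix u assume "u \<in> S"
  with wf show "g u = h u"
  proof (induction u rule: wf_induct_rule)
    case (less u)
    have arc: "(u, g u) \<in> arcs S g" using less.prems by (simp add: arcs_def)
    have "{u, g u} \<in> arc_edges S h"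
      using less.prems unfolding assms(4)[symmetric] by (auto simp: arc_edges_def)
    then obtain t where t: "t \<in> S" "{u, g u} = {t, h t}" by (auto simp: arc_edges_def)
    show ?case
    proof (cases "t = u")
      case True
      then show ?thesis using t by (auto simp: doubleton_eq_iff)
    next
      case False
      then have "t = g u" "h t = u" using t by (auto simp: doubleton_eq_iff)
      then have "g t = u" using less.IH[of t] t arc by auto
      then have "(t, u) \<in> arcs S g" using t by (auto simp: arcs_def)
      then have "(u, u) \<in> (arcs S g)\<^sup>+" using arc \<open>t = g u\<close> by (meson trancl.simps)
      then show ?thesis using ac by (auto simp: acyclic_def)
    qed
  qed
qed

text \<open>
  Every vertex is sent to a neighbour closer to the root, so the distance strictly decreases along arcs
  and no directed cycle arises.
\<close>

lemma connected_graph_rooted_forest_exists: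
  assumes "connected_graph G" "r \<in> vertices G"
  shows "\<exists>g. g \<in> rooted_forests G (vertices G - {r})"
proof -
  let ?S = "vertices G - {r}"
  let ?R = "{(a, b). {a, b} \<in> edges G}"
  define d where "d w = (LEAST k. (w, r) \<in> ?R ^^ k)" for w
  have "\<exists>z. {w, z} \<in> edges G \<and> d z < d w" if w: "w \<in> ?S" for w
  proof -
    have "(w, r) \<in> ?R\<^sup>*" using assms w by (auto simp: connected_graph_def)
    then have "\<exists>k. (w, r) \<in> ?R ^^ k" by (simp add: rtrancl_power)
    then have d: "(w, r) \<in> ?R ^^ d w" unfolding d_def by (rule LeastI_ex)
    then obtain k where k: "d w = Suc k" using w by (cases "d w") auto
    then obtain z where z: "(w, z) \<in> ?R" "(z, r) \<in> ?R ^^ k" using d relpow_Suc_D2 by metis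
    then have "d z \<le> k" unfolding d_def by (intro Least_le)
    then show ?thesis using z k by auto
  qed
  then obtain f where f: "\<And>w. w \<in> ?S \<Longrightarrow> {w, f w} \<in> edges G" "\<And>w. w \<in> ?S \<Longrightarrow> d (f w) < d w" by metis
  let ?g = "restrict f ?S"
  have "acyclic ((arcs ?S ?g)\<inverse>)"
    by (rule wf_acyclic, rule wf_subset[OF wf_measure[of d]]) (auto simp: arcs_def intro!: f(2))
  then have "?g \<in> rooted_forests G ?S"
    using f by (auto simp: rooted_forests_def neighbours_def acyclic_converse)
  then show ?thesis by blast
qed

text \<open>
  The edges of \<open>g\<close> already connect all vertices, so a further edge of \<open>T\<close> would close a
  cycle together with a path between its ends.
\<close>

lemma tree_graph_eq_arc_edges:
  assumes "tree_graph T" "r \<in> vertices T" "g \<in> rooted_forests T (vertices T - {r})"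
  shows "edges T = arc_edges (vertices T - {r}) g"
proof
  let ?S = "vertices T - {r}"
  have sim: "simple_graph T" using assms(1) by (simp add: tree_graph_def connected_graph_def)
  define F where "F = (vertices T, arc_edges ?S g)"
  have F: "subgraph_of F T" "tree_graph F"
    using rooted_forest_spanning_tree[OF sim assms(2,3)] by (auto simp: F_def)
  show "arc_edges ?S g \<subseteq> edges T" using F(1) by (simp add: subgraph_of_def F_def)
  show "edges T \<subseteq> arc_edges ?S g"
  proof
    fix e assume e: "e \<in> edges T"
    then obtain a b where ab: "e = {a, b}" "a \<noteq> b" "a \<in> vertices T" "b \<in> vertices T"
      by (rule simple_graph_edgeE[OF sim])
    show "e \<in> arc_edges ?S g"
    proof (rule ccontr)
      assume ne: "e \<notin> arc_edges ?S g"
      have "(a, b) \<in> {(a, b). {a, b} \<in> edges F}\<^sup>*"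
        using F(2) ab by (auto simp: tree_graph_def connected_graph_def F_def)
      then obtain xs where xs: "xs \<noteq> []" "hd xs = a" "last xs = b" "distinct xs"
        "successively (\<lambda>x y. {x, y} \<in> edges F) xs"
        using rtrancl_imp_distinct_path[of a b "{(a, b). {a, b} \<in> edges F}"] by auto
      have "length xs \<noteq> 1" using xs ab(2) by (cases xs) auto
      moreover have "length xs \<noteq> 2"
      proof
        assume "length xs = 2"
        then obtain x y where "xs = [x, y]" by (metis length_0_conv length_Suc_conv numeral_2_eq_2)
        then show False using xs ne ab by (simp add: F_def)
      qed
      ultimately have len: "3 \<le> length xs" using xs(1) by (cases xs; cases "tl xs"; cases "tl (tl xs)") auto
      have "successively (\<lambda>x y. {x, y} \<in> edges T) xs"
        using xs(5) F(1) by (auto simp: successively_conv_nth subgraph_of_def)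
      then have sub: "edges (cycle_of xs) \<subseteq> edges T"
        using e ab xs by (intro edges_cycle_of_subset) (auto simp: insert_commute)
      have cyc: "cycle_graph (cycle_of xs)" using len xs(4) cycle_graph_iff by blast
      then have simc: "simple_graph (cycle_of xs)"
        using cycle_graph_two_regular[OF cyc] by (simp add: two_regular_def)
      have "vertices (cycle_of xs) \<subseteq> vertices T"
      proof
        fix u assume "u \<in> vertices (cycle_of xs)"
        then have "vertex_degree (cycle_of xs) u = 2"
          using cycle_graph_two_regular[OF cyc] by (simp add: two_regular_def)
        then have "{e \<in> edges (cycle_of xs). u \<in> e} \<noteq> {}"
          by (metis card.empty vertex_degree_def zero_neq_numeral)
        then show "u \<in> vertices T" using sub edge_vertex[OF sim] by blast
      qed
      then have "subgraph_of (cycle_of xs) T" using sub simc by (simp add: subgraph_of_def)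
      then show False using assms(1) cyc unfolding tree_graph_def by blast
    qed
  qed
qed

text \<open>
  Forgetting the directions is a bijection, whatever the root. This is the matrix-tree theorem in terms
  of forests.
\<close>

lemma card_rooted_forests_eq_num_spanning_trees:
  assumes "connected_graph G" "r \<in> vertices G"
  shows "card (rooted_forests G (vertices G - {r})) = num_spanning_trees G"
  unfolding num_spanning_trees_def
proof (rule bij_betw_same_card)
  let ?S = "vertices G - {r}"
  let ?\<T> = "{T. subgraph_of T G \<and> vertices T = vertices G \<and> tree_graph T}"
  have sim: "simple_graph G" and fin: "finite ?S"
    using assms by (auto simp: connected_graph_def simple_graph_def)
  show "bij_betw (\<lambda>g. (vertices G, arc_edges ?S g)) (rooted_forests G ?S) ?\<T>"
  proof (rule bij_betw_imageI)
    show "inj_on (\<lambda>g. (vertices G, arc_edges ?S g)) (rooted_forests G ?S)"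
      using rooted_forest_determined_by_edges[OF fin] by (intro inj_onI) blast
    show "(\<lambda>g. (vertices G, arc_edges ?S g)) ` rooted_forests G ?S = ?\<T>"
    proof (intro equalityI subsetI)
      fix T assume T: "T \<in> ?\<T>"
      then have con: "connected_graph T" and rT: "r \<in> vertices T"
        using assms(2) by (auto simp: tree_graph_def)
      obtain g where g: "g \<in> rooted_forests T (vertices T - {r})"
        using connected_graph_rooted_forest_exists[OF con rT] by blast
      have "edges T = arc_edges ?S g"
        using tree_graph_eq_arc_edges[OF _ rT g] T by simp
      moreover have "g \<in> rooted_forests G ?S"
        using g T by (auto simp: rooted_forests_def PiE_iff neighbours_def subgraph_of_def)
      ultimately show "T \<in> (\<lambda>g. (vertices G, arc_edges ?S g)) ` rooted_forests G ?S"
        using T by (intro image_eqI[of _ _ g]) (auto simp: prod_eq_iff)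
    qed (use rooted_forest_spanning_tree[OF sim assms(2)] in auto)
  qed
qed

lemma num_spanning_trees_pos:
  assumes "connected_graph G"
  shows "num_spanning_trees G > 0"
proof -
  obtain r where r: "r \<in> vertices G" using assms by (auto simp: connected_graph_def)
  have "finite (rooted_forests G (vertices G - {r}))"
    using assms by (intro finite_rooted_forests) (auto simp: connected_graph_def simple_graph_def)
  then show ?thesis
    using connected_graph_rooted_forest_exists[OF assms r]
      card_rooted_forests_eq_num_spanning_trees[OF assms r] by (metis card_gt_0_iff empty_iff)
qed

section \<open>Orientations of 2-regular graphs\<close>

lemma arc_edges_restrict: "arc_edges A (restrict g A) = arc_edges A g"
  by (simp add: arc_edges_def cong: image_cong)

lemma arc_edges_Un: "arc_edges (A \<union> B) g = arc_edges A g \<union> arc_edges B g"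
  by (simp add: arc_edges_def image_Un)

lemma card_PiE_Un:
  assumes "A \<inter> B = {}" "X \<subseteq> PiE A F" "Y \<subseteq> PiE B F"
  shows "card {f \<in> PiE (A \<union> B) F. restrict f A \<in> X \<and> restrict f B \<in> Y} = card X * card Y"
proof -
  let ?join = "\<lambda>(p, q) u. if u \<in> A then p u else q u"
  have "bij_betw ?join (X \<times> Y) {f \<in> PiE (A \<union> B) F. restrict f A \<in> X \<and> restrict f B \<in> Y}"
  proof (rule bij_betw_byWitness[where f' = "\<lambda>f. (restrict f A, restrict f B)"])
    have rA: "restrict (?join (p, q)) A = p" if "p \<in> X" for p q
      using that assms(2) by (intro ext) (auto simp: restrict_def PiE_def extensional_def)
    have rB: "restrict (?join (p, q)) B = q" if "q \<in> Y" for p q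
      using that assms(1,3) by (intro ext) (auto simp: restrict_def PiE_def extensional_def)
    show "\<forall>a\<in>X \<times> Y. (restrict (?join a) A, restrict (?join a) B) = a"
      using rA rB by auto
    show "\<forall>f\<in>{f \<in> PiE (A \<union> B) F. restrict f A \<in> X \<and> restrict f B \<in> Y}.
        ?join (restrict f A, restrict f B) = f"
      by (auto simp: fun_eq_iff PiE_def extensional_def)
    have "?join (p, q) \<in> PiE (A \<union> B) F" if "p \<in> X" "q \<in> Y" for p q
    proof -
      have "p \<in> PiE A F" "q \<in> PiE B F" using that assms by auto
      then show ?thesis by (auto simp: PiE_iff extensional_def)
    qed
    then show "?join ` (X \<times> Y) \<subseteq> {f \<in> PiE (A \<union> B) F. restrict f A \<in> X \<and> restrict f B \<in> Y}"
      using rA rB by auto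
  qed auto
  from bij_betw_same_card[OF this] show ?thesis by (simp only: card_cartesian_product)
qed

text \<open>
  The edge chosen by \<open>u\<close> is recorded by its other end \<open>g u\<close>, so that an edge choice can be iterated
  like a forest. Injectivity excludes directed 2-cycles, and makes the choice a matching between
  vertices and edges.
\<close>

definition edge_choices :: "'a ugraph \<Rightarrow> 'a set \<Rightarrow> ('a \<Rightarrow> 'a) set" where
  "edge_choices G S = {g \<in> PiE S (neighbours G). inj_on (\<lambda>u. {u, g u}) S}"

text \<open>
  For a 2-regular graph these are the ways to pick a direction for each of its cycles.
\<close>

definition orientations :: "'a ugraph \<Rightarrow> ('a \<Rightarrow> 'a) set" where
  "orientations C = {h \<in> edge_choices C (vertices C). arc_edges (vertices C) h = edges C}"

lemma finite_edge_choices: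
  assumes "simple_graph G" "finite S"
  shows "finite (edge_choices G S)"
proof -
  have "finite (PiE S (neighbours G))"
    using assms by (intro finite_PiE finite_neighbours)
  then show ?thesis unfolding edge_choices_def by auto
qed

lemma orientations_subset_PiE:
  assumes "edges C \<subseteq> edges G"
  shows "orientations C \<subseteq> PiE (vertices C) (neighbours G)"
proof -
  have "PiE (vertices C) (neighbours C) \<subseteq> PiE (vertices C) (neighbours G)"
    using assms by (intro PiE_mono) (auto simp: neighbours_def)
  then show ?thesis unfolding orientations_def edge_choices_def by blast
qed

lemma edge_choices_edge:
  "g \<in> edge_choices G S \<Longrightarrow> u \<in> S \<Longrightarrow> {u, g u} \<in> edges G"
  unfolding edge_choices_def neighbours_def by auto

lemma edge_choicesI:
  assumes "g \<in> extensional S" "\<And>u. u \<in> S \<Longrightarrow> {u, g u} \<in> edges G" "inj_on (\<lambda>u. {u, g u}) S"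
  shows "g \<in> edge_choices G S"
  using assms unfolding edge_choices_def neighbours_def by (auto simp: PiE_def)

lemma edge_choices_restrict:
  assumes "g \<in> edge_choices G S" "A \<subseteq> S" "\<And>u. u \<in> A \<Longrightarrow> {u, g u} \<in> edges H"
  shows "restrict g A \<in> edge_choices H A"
proof (rule edge_choicesI)
  have "inj_on (\<lambda>u. {u, g u}) A"
    using assms(1,2) by (auto simp: edge_choices_def intro: inj_on_subset)
  then show "inj_on (\<lambda>u. {u, restrict g A u}) A" by (auto simp: inj_on_def)
qed (use assms in auto)

text \<open>
  The neighbours of \<open>u\<close> are \<open>\<sigma> u\<close> and \<open>\<rho> u\<close>, with \<open>\<rho>\<close> the inverse of \<open>\<sigma>\<close>. If
  \<open>h u = \<sigma> u\<close>, then \<open>h (\<sigma> u)\<close> cannot be \<open>u\<close>, since the edge \<open>{u, \<sigma> u}\<close> is already chosen by \<open>u\<close>. So \<open>h\<close>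
  follows \<open>\<sigma>\<close> all around the cycle as soon as it does so at one vertex, and \<open>\<rho>\<close> otherwise.
\<close>

lemma card_orientations_cycle:
  assumes "cyclic_rotation D \<sigma>"
  shows "card (orientations D) = 2"
proof -
  let ?V = "vertices D"
  define \<rho> where "\<rho> = inv_into ?V \<sigma>"
  have bij: "bij_betw \<sigma> ?V ?V" and E: "edges D = arc_edges ?V \<sigma>"
    and s1: "\<And>u. u \<in> ?V \<Longrightarrow> \<sigma> u \<noteq> u" and s2: "\<And>u. u \<in> ?V \<Longrightarrow> \<sigma> (\<sigma> u) \<noteq> u"
    and conn: "\<And>Y. Y \<inter> ?V \<noteq> {} \<Longrightarrow> \<forall>u\<in>Y \<inter> ?V. \<sigma> u \<in> Y \<Longrightarrow> ?V \<subseteq> Y" and ne: "?V \<noteq> {}"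
    using assms by (simp_all add: cyclic_rotation_def)
  have \<sigma>V: "\<sigma> u \<in> ?V" if "u \<in> ?V" for u using bij that by (auto simp: bij_betw_def)
  have \<rho>V: "\<rho> u \<in> ?V" and \<sigma>\<rho>: "\<sigma> (\<rho> u) = u" if "u \<in> ?V" for u
    using bij that unfolding \<rho>_def by (auto simp: bij_betw_def inv_into_into f_inv_into_f)
  have \<rho>\<sigma>: "\<rho> (\<sigma> u) = u" if "u \<in> ?V" for u
    using bij that unfolding \<rho>_def by (simp add: bij_betw_def)
  have inE: "{u, \<sigma> u} \<in> edges D" "{u, \<rho> u} \<in> edges D" if "u \<in> ?V" for u
  proof -
    show "{u, \<sigma> u} \<in> edges D" using that by (auto simp: E arc_edges_def)
    have "{u, \<rho> u} = {\<rho> u, \<sigma> (\<rho> u)}" using \<sigma>\<rho>[OF that] by auto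
    then show "{u, \<rho> u} \<in> edges D" using \<rho>V[OF that] by (auto simp: E arc_edges_def)
  qed
  have \<rho>E: "arc_edges ?V \<rho> = edges D"
  proof
    show "arc_edges ?V \<rho> \<subseteq> edges D" using inE(2) by (auto simp: arc_edges_def)
    show "edges D \<subseteq> arc_edges ?V \<rho>"
    proof
      fix e assume "e \<in> edges D"
      then obtain u where u: "u \<in> ?V" "e = {u, \<sigma> u}" by (auto simp: E arc_edges_def)
      then have "e = {\<sigma> u, \<rho> (\<sigma> u)}" using \<rho>\<sigma> by auto
      then show "e \<in> arc_edges ?V \<rho>" using \<sigma>V[OF u(1)] by (auto simp: arc_edges_def)
    qed
  qed
  have inj\<sigma>: "inj_on (\<lambda>u. {u, \<sigma> u}) ?V"
  proof (rule inj_onI)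
    fix u w assume "u \<in> ?V" "w \<in> ?V" "{u, \<sigma> u} = {w, \<sigma> w}"
    then show "u = w" using s2[of u] by (auto simp: doubleton_eq_iff)
  qed
  have inj\<rho>: "inj_on (\<lambda>u. {u, \<rho> u}) ?V"
  proof (rule inj_onI)
    fix u w assume uw: "u \<in> ?V" "w \<in> ?V" "{u, \<rho> u} = {w, \<rho> w}"
    show "u = w"
    proof (rule ccontr)
      assume "u \<noteq> w"
      then have "\<rho> u = w" "\<rho> w = u" using uw by (auto simp: doubleton_eq_iff)
      then have "\<sigma> (\<sigma> u) = u" using uw \<sigma>\<rho> by metis
      then show False using s2 uw by blast
    qed
  qed
  have "orientations D = {restrict \<sigma> ?V, restrict \<rho> ?V}"
  proof (intro equalityI subsetI)
    fix h assume h: "h \<in> orientations D"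
    have ext: "h \<in> extensional ?V" and injh: "inj_on (\<lambda>u. {u, h u}) ?V"
      using h by (auto simp: orientations_def edge_choices_def PiE_def)
    have alt: "h u = \<sigma> u \<or> h u = \<rho> u" if u: "u \<in> ?V" for u
    proof -
      have "{u, h u} \<in> edges D" using h u edge_choices_edge[of h D] by (auto simp: orientations_def)
      then obtain t where t: "t \<in> ?V" "{u, h u} = {t, \<sigma> t}" by (auto simp: E arc_edges_def)
      then show ?thesis using \<rho>\<sigma>[OF t(1)] by (auto simp: doubleton_eq_iff)
    qed
    have "\<forall>u\<in>?V. h u = \<rho> u" if "\<not> (\<forall>u\<in>?V. h u = \<sigma> u)"
    proof (rule ccontr)
      assume "\<not> (\<forall>u\<in>?V. h u = \<rho> u)"
      then have "{u \<in> ?V. h u = \<sigma> u} \<inter> ?V \<noteq> {}" using alt by blast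
      moreover have "\<forall>u\<in>{u \<in> ?V. h u = \<sigma> u} \<inter> ?V. \<sigma> u \<in> {u \<in> ?V. h u = \<sigma> u}"
      proof
        fix u assume "u \<in> {u \<in> ?V. h u = \<sigma> u} \<inter> ?V"
        then have u: "u \<in> ?V" "h u = \<sigma> u" by auto
        have "h (\<sigma> u) \<noteq> u"
        proof
          assume "h (\<sigma> u) = u"
          then have "{\<sigma> u, h (\<sigma> u)} = {u, h u}" using u by auto
          then have "\<sigma> u = u" using inj_onD[OF injh, of "\<sigma> u" u] \<sigma>V u by blast
          then show False using s1 u by blast
        qed
        then have "h (\<sigma> u) = \<sigma> (\<sigma> u)" using alt[OF \<sigma>V[OF u(1)]] \<rho>\<sigma>[OF u(1)] by auto
        then show "\<sigma> u \<in> {u \<in> ?V. h u = \<sigma> u}" using \<sigma>V u by auto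
      qed
      ultimately have "?V \<subseteq> {u \<in> ?V. h u = \<sigma> u}" by (rule conn)
      then show False using that by blast
    qed
    then consider "\<forall>u\<in>?V. h u = \<sigma> u" | "\<forall>u\<in>?V. h u = \<rho> u" by blast
    then show "h \<in> {restrict \<sigma> ?V, restrict \<rho> ?V}"
      by cases (use ext in \<open>auto simp: extensional_def fun_eq_iff restrict_def\<close>)
  next
    fix h assume h: "h \<in> {restrict \<sigma> ?V, restrict \<rho> ?V}"
    have "restrict \<sigma> ?V \<in> edge_choices D ?V"
      by (rule edge_choicesI) (use inj\<sigma> inE in \<open>auto simp: inj_on_def\<close>)
    moreover have "restrict \<rho> ?V \<in> edge_choices D ?V"
      by (rule edge_choicesI) (use inj\<rho> inE in \<open>auto simp: inj_on_def\<close>)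
    moreover have "arc_edges ?V (restrict \<sigma> ?V) = edges D" "arc_edges ?V (restrict \<rho> ?V) = edges D"
      unfolding arc_edges_restrict by (fact E[symmetric], fact \<rho>E)
    ultimately show "h \<in> orientations D"
      using h unfolding orientations_def by blast
  qed
  moreover have "restrict \<sigma> ?V \<noteq> restrict \<rho> ?V"
  proof
    assume eq: "restrict \<sigma> ?V = restrict \<rho> ?V"
    obtain u where u: "u \<in> ?V" using ne by blast
    then have "\<sigma> u = \<rho> u" using eq by (metis restrict_apply')
    then show False using s2[OF u] \<sigma>\<rho>[OF u] by simp
  qed
  ultimately show ?thesis by simp
qed

lemma arc_edges_split:
  assumes "arc_edges A g \<subseteq> X" "arc_edges B g \<subseteq> Y" "X \<inter> Y = {}" "arc_edges (A \<union> B) g = X \<union> Y"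
  shows "arc_edges A g = X" "arc_edges B g = Y"
  using assms unfolding arc_edges_Un by blast+

lemma card_orientations_disjoint_union:
  assumes C: "simple_graph C" and D: "simple_graph D" and dis: "vertices C \<inter> vertices D = {}"
  shows "card (orientations (vertices C \<union> vertices D, edges C \<union> edges D)) =
    card (orientations C) * card (orientations D)"
proof -
  let ?U = "(vertices C \<union> vertices D, edges C \<union> edges D)"
  have EC: "e \<subseteq> vertices C" if "e \<in> edges C" for e using C that by (auto simp: simple_graph_def)
  have ED: "e \<subseteq> vertices D" if "e \<in> edges D" for e using D that by (auto simp: simple_graph_def)
  have EE: "edges C \<inter> edges D = {}"
  proof (rule equals0I)
    fix e assume "e \<in> edges C \<inter> edges D"
    then have "e \<subseteq> {}" using EC[of e] ED[of e] dis by blast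
    then show False using C \<open>e \<in> _\<close> by (auto simp: simple_graph_def)
  qed
  have "orientations ?U = {f \<in> PiE (vertices C \<union> vertices D) (neighbours ?U).
      restrict f (vertices C) \<in> orientations C \<and> restrict f (vertices D) \<in> orientations D}"
  proof (intro equalityI subsetI)
    fix f assume f: "f \<in> orientations ?U"
    then have fU: "f \<in> edge_choices ?U (vertices C \<union> vertices D)" by (simp add: orientations_def)
    have c: "{u, f u} \<in> edges C" if "u \<in> vertices C" for u
      using edge_choices_edge[OF fU, of u] that ED dis by auto
    have d: "{u, f u} \<in> edges D" if "u \<in> vertices D" for u
      using edge_choices_edge[OF fU, of u] that EC dis by auto
    have "arc_edges (vertices C) f = edges C" "arc_edges (vertices D) f = edges D"
      using c d f EE by (intro arc_edges_split[where A = "vertices C" and B = "vertices D" and X = "edges C" and Y = "edges D"];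
        auto simp: arc_edges_def orientations_def)+
    then show "f \<in> {f \<in> PiE (vertices C \<union> vertices D) (neighbours ?U).
      restrict f (vertices C) \<in> orientations C \<and> restrict f (vertices D) \<in> orientations D}"
      using edge_choices_restrict[OF fU _ c] edge_choices_restrict[OF fU _ d] fU
      by (auto simp: orientations_def arc_edges_restrict edge_choices_def)
  next
    fix f assume f: "f \<in> {f \<in> PiE (vertices C \<union> vertices D) (neighbours ?U).
      restrict f (vertices C) \<in> orientations C \<and> restrict f (vertices D) \<in> orientations D}"
    then have E: "arc_edges (vertices C) f = edges C" "arc_edges (vertices D) f = edges D"
      by (auto simp: orientations_def arc_edges_restrict)
    have "inj_on (\<lambda>u. {u, restrict f (vertices C) u}) (vertices C)"
      "inj_on (\<lambda>u. {u, restrict f (vertices D) u}) (vertices D)"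
      using f by (auto simp: orientations_def edge_choices_def)
    then have "inj_on (\<lambda>u. {u, f u}) (vertices C)" "inj_on (\<lambda>u. {u, f u}) (vertices D)"
      by (auto simp: inj_on_def)
    then have "inj_on (\<lambda>u. {u, f u}) (vertices C \<union> vertices D)"
      using EE E unfolding inj_on_Un arc_edges_def by blast
    then show "f \<in> orientations ?U"
      using f E by (auto simp: orientations_def edge_choices_def arc_edges_Un)
  qed
  then show ?thesis
  proof (simp only:, intro card_PiE_Un dis)
    show "orientations C \<subseteq> PiE (vertices C) (neighbours ?U)"
      by (rule orientations_subset_PiE) simp
    show "orientations D \<subseteq> PiE (vertices D) (neighbours ?U)"
      by (rule orientations_subset_PiE) simp
  qed
qed

lemma num_cycles_empty: "num_cycles (({}, {}) :: 'a ugraph) = 0"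
proof -
  have "\<not> (subgraph_of D ({}, {}) \<and> cycle_graph D)" for D :: "'a ugraph"
    by (auto simp: subgraph_of_def cycle_graph_def)
  then have "{D. subgraph_of D (({}, {}) :: 'a ugraph) \<and> cycle_graph D} = {}" by blast
  then show ?thesis unfolding num_cycles_def by (simp only: card.empty)
qed

lemma simple_graph_no_vertices: "simple_graph C \<Longrightarrow> vertices C = {} \<Longrightarrow> C = ({}, {})"
  by (auto simp: simple_graph_def prod_eq_iff)

text \<open>
  Removing one cycle divides the number of orientations by 2, the number of its directions.
\<close>

lemma card_orientations:
  assumes "two_regular C"
  shows "card (orientations C) = 2 ^ num_cycles C"
  using assms
proof (induction "card (vertices C)" arbitrary: C rule: less_induct)
  case less
  have sim: "simple_graph C" and fin: "finite (vertices C)"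
    using less.prems by (auto simp: two_regular_def simple_graph_def)
  show ?case
  proof (cases "vertices C = {}")
    case True
    then have "C = ({}, {})" using sim by (rule simple_graph_no_vertices[rotated])
    then show ?thesis
      by (simp add: num_cycles_empty orientations_def edge_choices_def arc_edges_def)
  next
    case False
    then obtain D where D: "cycle_graph D" "subgraph_of D C"
      using two_regular_has_cycle[OF less.prems] by blast
    let ?C' = "delete_subgraph C D"
    have split: "C = (vertices ?C' \<union> vertices D, edges ?C' \<union> edges D)"
      using delete_cycle_vertices[OF less.prems D] delete_cycle_edges[OF less.prems D]
      by (simp add: prod_eq_iff)
    have dis: "vertices ?C' \<inter> vertices D = {}" by (auto simp: delete_subgraph_def)
    have C': "two_regular ?C'" by (rule delete_cycle_two_regular[OF less.prems D])
    have "vertices D \<noteq> {}" using D(1) by (auto simp: cycle_graph_def)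
    then have "vertices ?C' \<subset> vertices C"
      using D(2) by (auto simp: delete_subgraph_def subgraph_of_def)
    then have "card (vertices ?C') < card (vertices C)" using fin by (rule psubset_card_mono[rotated])
    then have IH: "card (orientations ?C') = 2 ^ num_cycles ?C'" using C' by (rule less.hyps)
    obtain \<sigma> where "cyclic_rotation D \<sigma>" by (rule cycle_graph_cyclic_rotation[OF D(1)])
    then have "card (orientations D) = 2" by (rule card_orientations_cycle)
    moreover have "card (orientations C) = card (orientations ?C') * card (orientations D)"
      using C' D(2) dis
      by (subst split, intro card_orientations_disjoint_union) (auto simp: two_regular_def subgraph_of_def)
    ultimately show ?thesis
      using IH num_cycles_delete_cycle[OF less.prems D] by simp
  qed
qed

text \<open>
  The restrictions to \<open>C\<close> and to its complement are independent: the edges chosen inside \<open>C\<close>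
  are edges of \<open>C\<close>, whereas an edge chosen by a vertex outside \<open>C\<close> has that vertex as an end.
\<close>

lemma card_edge_choices_traversing:
  assumes G: "simple_graph G" and C: "subgraph_of C G" "vertices C \<subseteq> S"
  shows "card {g \<in> edge_choices G S. arc_edges (vertices C) g = edges C} =
    card (orientations C) * card (edge_choices G (S - vertices C))"
proof -
  let ?A = "vertices C" and ?B = "S - vertices C"
  have S: "S = ?A \<union> ?B" using C by auto
  have EC: "e \<subseteq> vertices C" if "e \<in> edges C" for e
    using C that by (auto simp: subgraph_of_def simple_graph_def)
  have "{g \<in> edge_choices G S. arc_edges ?A g = edges C} = {f \<in> PiE (?A \<union> ?B) (neighbours G).
      restrict f ?A \<in> orientations C \<and> restrict f ?B \<in> edge_choices G ?B}"
  proof (intro equalityI subsetI)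
    fix f assume "f \<in> {g \<in> edge_choices G S. arc_edges ?A g = edges C}"
    then have f: "f \<in> edge_choices G S" "arc_edges ?A f = edges C" by auto
    have "restrict f ?A \<in> edge_choices C ?A"
      using f(2) by (intro edge_choices_restrict[OF f(1) C(2)]) (auto simp: arc_edges_def)
    moreover have "restrict f ?B \<in> edge_choices G ?B"
      using edge_choices_edge[OF f(1)] by (intro edge_choices_restrict[OF f(1)]) auto
    ultimately show "f \<in> {f \<in> PiE (?A \<union> ?B) (neighbours G).
      restrict f ?A \<in> orientations C \<and> restrict f ?B \<in> edge_choices G ?B}"
      using f S by (auto simp: orientations_def arc_edges_restrict edge_choices_def)
  next
    fix f assume f: "f \<in> {f \<in> PiE (?A \<union> ?B) (neighbours G).
      restrict f ?A \<in> orientations C \<and> restrict f ?B \<in> edge_choices G ?B}"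
    then have E: "arc_edges ?A f = edges C" by (auto simp: orientations_def arc_edges_restrict)
    have "inj_on (\<lambda>u. {u, restrict f ?A u}) ?A" "inj_on (\<lambda>u. {u, restrict f ?B u}) ?B"
      using f by (auto simp: orientations_def edge_choices_def)
    then have inj: "inj_on (\<lambda>u. {u, f u}) ?A" "inj_on (\<lambda>u. {u, f u}) ?B"
      by (auto simp: inj_on_def)
    have "(\<lambda>u. {u, f u}) ` ?A \<inter> (\<lambda>u. {u, f u}) ` ?B = {}"
    proof (rule equals0I)
      fix e assume "e \<in> (\<lambda>u. {u, f u}) ` ?A \<inter> (\<lambda>u. {u, f u}) ` ?B"
      then obtain w where "w \<in> ?B" "e = {w, f w}" "e \<in> edges C"
        using E by (auto simp: arc_edges_def)
      then show False using EC[of e] by blast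
    qed
    then have "inj_on (\<lambda>u. {u, f u}) (?A \<union> ?B)"
      using inj unfolding inj_on_Un by auto
    then show "f \<in> {g \<in> edge_choices G S. arc_edges ?A g = edges C}"
      using f E S by (auto simp: edge_choices_def)
  qed
  also have "card \<dots> = card (orientations C) * card (edge_choices G ?B)"
  proof (rule card_PiE_Un)
    show "orientations C \<subseteq> PiE ?A (neighbours G)"
      using C(1) by (intro orientations_subset_PiE) (simp add: subgraph_of_def)
  qed (auto simp: edge_choices_def)
  finally show ?thesis .
qed

section \<open>Inclusion-exclusion over directed cycles\<close>

text \<open>
  Following \<open>g\<close> from a vertex that returns to itself gives a directed cycle. It has length at least 3,
  because a 2-cycle would choose the same edge twice.
\<close>

lemma edge_choice_cycle_exists:
  assumes "simple_graph G" "g \<in> edge_choices G S" "\<not> acyclic (arcs S g)"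
  obtains D where "cycle_graph D" "vertices D \<subseteq> S" "cyclic_rotation D g"
proof -
  obtain w where "(w, w) \<in> (arcs S g)\<^sup>+" using assms(3) by (auto simp: acyclic_def)
  then obtain z where "(w, z) \<in> arcs S g" "(z, w) \<in> (arcs S g)\<^sup>*" by (meson tranclD)
  then have w: "w \<in> S" "(g w, w) \<in> (arcs S g)\<^sup>*" by (auto simp: arcs_def)
  obtain xs where xs: "xs \<noteq> []" "hd xs = g w" "last xs = w" "distinct xs"
    "successively (\<lambda>x y. (x, y) \<in> arcs S g) xs"
    using rtrancl_imp_distinct_path[OF w(2)] by blast
  have step: "g (xs ! i) = xs ! (Suc i mod length xs)" "xs ! i \<in> S" if "i < length xs" for i
  proof -
    have "g (xs ! i) = xs ! (Suc i mod length xs) \<and> xs ! i \<in> S"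
    proof (cases "Suc i < length xs")
      case True
      then have "(xs ! i, xs ! Suc i) \<in> arcs S g" using xs(5) by (auto simp: successively_conv_nth)
      then show ?thesis using True by (auto simp: arcs_def)
    next
      case False
      then have "i = length xs - 1" "Suc i = length xs" using that by auto
      then show ?thesis using xs w by (simp add: last_conv_nth hd_conv_nth)
    qed
    then show "g (xs ! i) = xs ! (Suc i mod length xs)" "xs ! i \<in> S" by auto
  qed
  have gw: "g w \<noteq> w" using edge_choices_edge[OF assms(2) w(1)] assms(1) by (auto simp: simple_graph_def)
  have "length xs \<noteq> 1" using xs gw by (cases xs) auto
  moreover have "length xs \<noteq> 2"
  proof
    assume "length xs = 2"
    then have "xs ! 0 = g w" "xs ! 1 = w" using xs by (auto simp: last_conv_nth hd_conv_nth)
    then have "g w \<in> S" "g (g w) = w" using step[of 0] \<open>length xs = 2\<close> by auto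
    moreover from this have "{g w, g (g w)} = {w, g w}" by auto
    ultimately show False using assms(2) w(1) gw by (auto simp: edge_choices_def dest: inj_onD)
  qed
  ultimately have len: "3 \<le> length xs" using xs(1) by (cases xs; cases "tl xs"; cases "tl (tl xs)") auto
  show ?thesis
  proof (rule that)
    show "cycle_graph (cycle_of xs)" using len xs(4) cycle_graph_iff by blast
    show "vertices (cycle_of xs) \<subseteq> S" using step(2) by (auto simp: cycle_of_def in_set_conv_nth)
    show "cyclic_rotation (cycle_of xs) g"
      using len xs(4) step(1) by (rule cyclic_rotation_cycle_of)
  qed
qed

text \<open>
  The empty graph is included; it accounts for the leading term without a subgraph \<open>C\<close>.
\<close>

definition two_regular_within :: "'a ugraph \<Rightarrow> 'a set \<Rightarrow> 'a ugraph set" where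
  "two_regular_within G S = {C. subgraph_of C G \<and> two_regular C \<and> vertices C \<subseteq> S}"

lemma finite_two_regular_within:
  assumes "simple_graph G"
  shows "finite (two_regular_within G S)"
proof (rule finite_subset)
  show "two_regular_within G S \<subseteq> Pow (vertices G) \<times> Pow (edges G)"
    by (auto simp: two_regular_within_def subgraph_of_def)
  show "finite (Pow (vertices G) \<times> Pow (edges G))"
    using assms finite_edges[OF assms] by (auto simp: simple_graph_def)
qed

text \<open>
  The graphs \<open>C\<close> in the sum are the unions of directed cycles of \<open>g\<close>. If there are none, only the empty
  graph remains. Otherwise fix one directed cycle \<open>D\<close>: since \<open>V(C)\<close> is closed under \<open>g\<close>, each
  \<open>C\<close> contains \<open>D\<close> or is disjoint from it, and adding or removing \<open>D\<close> pairs these graphs with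
  opposite signs.
\<close>

lemma sum_traversed_two_regular:
  assumes G: "simple_graph G" and S: "finite S" and g: "g \<in> edge_choices G S"
  shows "(\<Sum>C | C \<in> two_regular_within G S \<and> arc_edges (vertices C) g = edges C. (- 1) ^ num_cycles C)
    = (of_bool (acyclic (arcs S g)) :: real)"
proof (cases "acyclic (arcs S g)")
  case True
  have "{C \<in> two_regular_within G S. arc_edges (vertices C) g = edges C} = {({}, {})}"
  proof (intro equalityI subsetI)
    fix C assume "C \<in> {C \<in> two_regular_within G S. arc_edges (vertices C) g = edges C}"
    then have C: "simple_graph C" "vertices C \<subseteq> S" "arc_edges (vertices C) g = edges C"
      by (auto simp: two_regular_within_def subgraph_of_def)
    have "vertices C = {}"
    proof (rule ccontr)
      assume "vertices C \<noteq> {}"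
      then obtain a where "a \<in> vertices C" by blast
      moreover have "wf ((arcs S g)\<inverse>)"
        using S True by (intro finite_acyclic_wf_converse) (auto simp: arcs_def)
      ultimately obtain u where u: "u \<in> vertices C" "\<And>t. (t, u) \<in> (arcs S g)\<inverse> \<Longrightarrow> t \<notin> vertices C"
        by (metis wfE_min)
      have "(g u, u) \<in> (arcs S g)\<inverse>" using u(1) C(2) by (auto simp: arcs_def)
      then have "g u \<notin> vertices C" by (rule u(2))
      moreover have "{u, g u} \<in> edges C" using u(1) C(3) by (auto simp: arc_edges_def)
      ultimately show False using edge_vertex[OF C(1)] by blast
    qed
    then show "C \<in> {({}, {})}" using simple_graph_no_vertices[OF C(1)] by simp
  next
    fix C :: "'a ugraph" assume "C \<in> {({}, {})}"
    then show "C \<in> {C \<in> two_regular_within G S. arc_edges (vertices C) g = edges C}"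
      by (auto simp: two_regular_within_def subgraph_of_def two_regular_def simple_graph_def arc_edges_def)
  qed
  then show ?thesis using True by (simp add: num_cycles_empty)
next
  case False
  then obtain D where D: "cycle_graph D" "vertices D \<subseteq> S" "cyclic_rotation D g"
    using edge_choice_cycle_exists[OF G g] by blast
  have twoD: "two_regular D" by (rule cycle_graph_two_regular[OF D(1)])
  have ED: "arc_edges (vertices D) g = edges D" and Dne: "vertices D \<noteq> {}"
    and conn: "\<And>Y. Y \<inter> vertices D \<noteq> {} \<Longrightarrow> \<forall>u\<in>Y \<inter> vertices D. g u \<in> Y \<Longrightarrow> vertices D \<subseteq> Y"
    using D(3) by (auto simp: cyclic_rotation_def)
  have subD: "subgraph_of D G"
  proof -
    have "edges D \<subseteq> edges G"
      using edge_choices_edge[OF g] D(2) unfolding ED[symmetric] by (auto simp: arc_edges_def)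
    moreover have "u \<in> vertices G" if "u \<in> vertices D" for u
      using edge_choices_edge[OF g, of u] that D(2) edge_vertex[OF G, of "{u, g u}" u] by auto
    ultimately show ?thesis using twoD by (auto simp: subgraph_of_def two_regular_def)
  qed
  define X where "X = {C \<in> two_regular_within G S. arc_edges (vertices C) g = edges C}"
  define X0 where "X0 = {C \<in> X. vertices C \<inter> vertices D = {}}"
  define X1 where "X1 = {C \<in> X. vertices D \<subseteq> vertices C}"
  define add where "add C = (vertices C \<union> vertices D, edges C \<union> edges D)" for C
  have finX: "finite X" unfolding X_def using finite_two_regular_within[OF G] by simp
  have "X = X0 \<union> X1"
  proof -
    have "vertices D \<subseteq> vertices C" if C: "C \<in> X" "vertices C \<inter> vertices D \<noteq> {}" for C
    proof (rule conn[OF C(2)], rule ballI)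
      fix u assume "u \<in> vertices C \<inter> vertices D"
      then have "{u, g u} \<in> edges C" using C(1) by (auto simp: X_def arc_edges_def)
      then show "g u \<in> vertices C"
        using C(1) edge_vertex by (fastforce simp: X_def two_regular_within_def two_regular_def)
    qed
    then show ?thesis by (auto simp: X0_def X1_def)
  qed
  moreover have "X0 \<inter> X1 = {}" using Dne by (auto simp: X0_def X1_def)
  ultimately have "(\<Sum>C\<in>X. (- 1) ^ num_cycles C) =
      (\<Sum>C\<in>X0. (- 1) ^ num_cycles C) + (\<Sum>C\<in>X1. (- 1 :: real) ^ num_cycles C)"
    using finX by (metis finite_Un sum.union_disjoint)
  also have "(\<Sum>C\<in>X1. (- 1 :: real) ^ num_cycles C) = (\<Sum>C\<in>X0. - ((- 1) ^ num_cycles C))"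
  proof (rule sum.reindex_bij_witness[of _ add "\<lambda>C. delete_subgraph C D"])
    fix C assume "C \<in> X1"
    then have C: "subgraph_of C G" "two_regular C" "vertices C \<subseteq> S"
      "arc_edges (vertices C) g = edges C" "vertices D \<subseteq> vertices C"
      by (auto simp: X1_def X_def two_regular_within_def)
    have DC: "subgraph_of D C"
      using C(5) twoD image_mono[OF C(5), of "\<lambda>u. {u, g u}"] C(4) ED
      by (simp add: subgraph_of_def two_regular_def arc_edges_def)
    note del = delete_cycle_vertices[OF C(2) D(1) DC] delete_cycle_edges[OF C(2) D(1) DC]
    show "add (delete_subgraph C D) = C"
      using del by (simp add: add_def prod_eq_iff)
    have "arc_edges (vertices (delete_subgraph C D)) g = edges (delete_subgraph C D)"
    proof
      show "arc_edges (vertices (delete_subgraph C D)) g \<subseteq> edges (delete_subgraph C D)"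
      proof
        fix e assume "e \<in> arc_edges (vertices (delete_subgraph C D)) g"
        then obtain u where u: "u \<in> vertices C" "u \<notin> vertices D" "e = {u, g u}"
          by (auto simp: arc_edges_def delete_subgraph_def)
        then have "e \<in> edges C" using C(4) by (auto simp: arc_edges_def)
        moreover have "e \<notin> edges D" using u edge_vertex[of D e u] twoD by (auto simp: two_regular_def)
        ultimately show "e \<in> edges (delete_subgraph C D)" using del(2) by blast
      qed
      show "edges (delete_subgraph C D) \<subseteq> arc_edges (vertices (delete_subgraph C D)) g"
        unfolding delete_subgraph_def C(4)[symmetric] by (auto simp: arc_edges_def)
    qed
    then show "delete_subgraph C D \<in> X0"
      using delete_cycle_two_regular[OF C(2) D(1) DC] C(3)
        subgraph_of_trans[OF delete_cycle_subgraph[OF C(2) D(1) DC] C(1)]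
      by (auto simp: X0_def X_def two_regular_within_def) (auto simp: delete_subgraph_def)
    show "- ((- 1) ^ num_cycles (delete_subgraph C D)) = (- 1 :: real) ^ num_cycles C"
      using num_cycles_delete_cycle[OF C(2) D(1) DC] by simp
  next
    fix C assume "C \<in> X0"
    then have C: "subgraph_of C G" "two_regular C" "vertices C \<subseteq> S"
      "arc_edges (vertices C) g = edges C" "vertices C \<inter> vertices D = {}"
      by (auto simp: X0_def X_def two_regular_within_def)
    have "two_regular (add C)" unfolding add_def by (rule two_regular_disjoint_union[OF C(2) twoD C(5)])
    then show "add C \<in> X1"
      using C D(2) ED subD
      by (auto simp: X1_def X_def two_regular_within_def add_def subgraph_of_def two_regular_def arc_edges_Un)
    have "e \<inter> vertices D = {}" if "e \<in> edges C" for e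
      using C(2,5) edge_vertex[of C e] that by (auto simp: two_regular_def)
    moreover have "e \<inter> vertices D \<noteq> {}" if "e \<in> edges D" for e
    proof -
      have "e \<subseteq> vertices D" "card e = 2"
        using twoD that by (auto simp: two_regular_def simple_graph_def)
      then show ?thesis by (metis Int_absorb2 card.empty zero_neq_numeral)
    qed
    ultimately show "delete_subgraph (add C) D = C"
      using C(5) by (auto simp: delete_subgraph_def add_def prod_eq_iff)
  qed
  also have "(\<Sum>C\<in>X0. (- 1) ^ num_cycles C) + \<dots> = 0" by (simp add: sum_negf)
  finally show ?thesis using False by (simp add: X_def)
qed

text \<open>
  Forests are the acyclic edge choices. The indicator of acyclicity is replaced by the
  alternating sum over 2-regular graphs, and the order of summation is exchanged.
\<close>

lemma card_rooted_forests_expansion: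
  assumes G: "simple_graph G" and S: "finite S"
  shows "real (card (rooted_forests G S)) =
    (\<Sum>C\<in>two_regular_within G S. (- 2) ^ num_cycles C * real (card (edge_choices G (S - vertices C))))"
proof -
  have fin: "finite (edge_choices G S)" by (rule finite_edge_choices[OF assms])
  have eq: "rooted_forests G S = {g \<in> edge_choices G S. acyclic (arcs S g)}"
    using acyclic_imp_arc_edges_inj by (auto simp: rooted_forests_def edge_choices_def)
  have "real (card (rooted_forests G S)) = (\<Sum>g\<in>edge_choices G S. of_bool (acyclic (arcs S g)))"
    using fin by (simp add: eq Int_def)
  also have "\<dots> = (\<Sum>g\<in>edge_choices G S.
      \<Sum>C | C \<in> two_regular_within G S \<and> arc_edges (vertices C) g = edges C. (- 1) ^ num_cycles C)"
    using sum_traversed_two_regular[OF assms] by simp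
  also have "\<dots> = (\<Sum>C\<in>two_regular_within G S.
      \<Sum>g | g \<in> edge_choices G S \<and> arc_edges (vertices C) g = edges C. (- 1) ^ num_cycles C)"
    by (rule sum.swap_restrict[OF fin finite_two_regular_within[OF G]])
  also have "\<dots> = (\<Sum>C\<in>two_regular_within G S.
      (- 2) ^ num_cycles C * real (card (edge_choices G (S - vertices C))))"
  proof (rule sum.cong[OF refl])
    fix C assume "C \<in> two_regular_within G S"
    then have C: "subgraph_of C G" "two_regular C" "vertices C \<subseteq> S"
      by (auto simp: two_regular_within_def)
    have "(- 1 :: real) ^ k * 2 ^ k = (- 2) ^ k" for k
      by (simp flip: power_mult_distrib)
    then show "(\<Sum>g | g \<in> edge_choices G S \<and> arc_edges (vertices C) g = edges C. (- 1) ^ num_cycles C) =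
      (- 2 :: real) ^ num_cycles C * real (card (edge_choices G (S - vertices C)))"
      using card_edge_choices_traversing[OF G C(1,3)] card_orientations[OF C(2)]
      by (simp add: mult_ac)
  qed
  finally show ?thesis .
qed

section \<open>Matchings of the subdivision graph\<close>

lemma subdivision_weight_edge: "subdivision_weight \<omega> {Inl u, Inr e} = 1 / \<omega> u"
  by (simp add: subdivision_weight_def)

lemma edges_delete_subdivision:
  assumes "simple_graph G" "subgraph_of C G"
  shows "f \<in> edges (delete_subgraph (subdivision_graph G) (subdivision_graph C)) \<longleftrightarrow>
    (\<exists>u e. f = {Inl u, Inr e} \<and> e \<in> edges G \<and> u \<in> e \<and> u \<in> vertices G - vertices C)"
    (is "?l \<longleftrightarrow> ?r")
proof
  assume ?l
  then obtain u e where "f = {Inl u, Inr e}" "e \<in> edges G" "u \<in> e" "u \<notin> vertices C"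
    by (auto simp: delete_subgraph_def subdivision_graph_def)
  then show ?r using edge_vertex[OF assms(1)] by blast
next
  assume ?r
  then obtain u e where f: "f = {Inl u, Inr e}" "e \<in> edges G" "u \<in> e" "u \<notin> vertices C" by blast
  have "simple_graph C" using assms(2) by (simp add: subgraph_of_def)
  then have "e \<notin> edges C" using edge_vertex f by metis
  then show ?l using f by (auto simp: delete_subgraph_def subdivision_graph_def)
qed

text \<open>
  The edge choice \<open>g\<close> on \<open>T\<close>, seen as a set of edges of the subdivision graph.
\<close>

definition choice_matching :: "'a set \<Rightarrow> ('a \<Rightarrow> 'a) \<Rightarrow> ('a + 'a set) set set" where
  "choice_matching T g = (\<lambda>u. {Inl u, Inr {u, g u}}) ` T"

lemma choice_matching_iff:
  "{Inl u, Inr e} \<in> choice_matching T g \<longleftrightarrow> u \<in> T \<and> e = {u, g u}"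
proof -
  have "{Inl u, Inr e} = {Inl w, Inr {w, g w}} \<longleftrightarrow> u = w \<and> e = {w, g w}" for w
    by (simp add: doubleton_eq_iff)
  then show ?thesis unfolding choice_matching_def image_iff by auto
qed

lemma inj_choice_matching_edge: "inj_on (\<lambda>u. {Inl u, Inr {u, g u}}) T"
  by (auto simp: inj_on_def doubleton_eq_iff)

lemma card_choice_matching: "card (choice_matching T g) = card T"
  unfolding choice_matching_def by (rule card_image[OF inj_choice_matching_edge])

lemma graph_matching_choice_matching:
  assumes G: "simple_graph G" and C: "subgraph_of C G"
    and T: "T \<subseteq> vertices G - vertices C" and g: "g \<in> edge_choices G T"
  shows "graph_matching (delete_subgraph (subdivision_graph G) (subdivision_graph C)) (choice_matching T g)"
  unfolding graph_matching_def
proof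
  show "choice_matching T g \<subseteq> edges (delete_subgraph (subdivision_graph G) (subdivision_graph C))"
  proof
    fix f assume "f \<in> choice_matching T g"
    then obtain u where u: "u \<in> T" "f = {Inl u, Inr {u, g u}}" by (auto simp: choice_matching_def)
    then show "f \<in> edges (delete_subgraph (subdivision_graph G) (subdivision_graph C))"
      unfolding edges_delete_subdivision[OF G C] using T edge_choices_edge[OF g u(1)] by blast
  qed
  show "pairwise disjnt (choice_matching T g)"
  proof (rule pairwiseI)
    fix f f' assume "f \<in> choice_matching T g" "f' \<in> choice_matching T g" "f \<noteq> f'"
    then obtain u w where uw: "u \<in> T" "w \<in> T" "u \<noteq> w"
      "f = {Inl u, Inr {u, g u}}" "f' = {Inl w, Inr {w, g w}}"
      unfolding choice_matching_def by blast
    then have "{u, g u} \<noteq> {w, g w}" using g by (auto simp: edge_choices_def dest: inj_onD)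
    then show "disjnt f f'" using uw by (simp add: disjnt_def)
  qed
qed

text \<open>
  Every edge of the subdivision graph joins an old vertex to a new one. Disjointness at the old
  vertices makes the matching a function on the set \<open>T\<close> of covered old vertices, and disjointness
  at the new ones makes that function injective on edges.
\<close>

lemma graph_matching_is_choice_matching:
  assumes G: "simple_graph G" and C: "subgraph_of C G"
    and M: "graph_matching (delete_subgraph (subdivision_graph G) (subdivision_graph C)) M"
  obtains T g where "T \<subseteq> vertices G - vertices C" "g \<in> edge_choices G T" "M = choice_matching T g"
proof -
  have ME: "\<exists>u e. f = {Inl u, Inr e} \<and> e \<in> edges G \<and> u \<in> e \<and> u \<in> vertices G - vertices C"
    if "f \<in> M" for f
    using M that edges_delete_subdivision[OF G C] by (auto simp: graph_matching_def)
  have disj: "f = f'" if "f \<in> M" "f' \<in> M" "f \<inter> f' \<noteq> {}" for f f'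
    using M that by (auto simp: graph_matching_def pairwise_def disjnt_def)
  have ME': "e \<in> edges G \<and> u \<in> e \<and> u \<in> vertices G - vertices C" if "{Inl u, Inr e} \<in> M" for u e
    using ME[OF that] by (auto simp: doubleton_eq_iff)
  define T where "T = {u. \<exists>e. {Inl u, Inr e} \<in> M}"
  have "\<exists>w. {Inl u, Inr {u, w}} \<in> M" if u: "u \<in> T" for u
  proof -
    obtain e where e: "{Inl u, Inr e} \<in> M" using u by (auto simp: T_def)
    then have "e \<in> edges G" "u \<in> e" using ME' by blast+
    then obtain w where "e = {u, w}" by (rule incident_edgeE[OF G])
    then show ?thesis using e by blast
  qed
  then obtain h where h: "\<And>u. u \<in> T \<Longrightarrow> {Inl u, Inr {u, h u}} \<in> M" by metis
  define g where "g = restrict h T"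
  have g: "{Inl u, Inr {u, g u}} \<in> M" if "u \<in> T" for u using h that by (simp add: g_def)
  show ?thesis
  proof (rule that)
    show "T \<subseteq> vertices G - vertices C" using ME' by (fastforce simp: T_def)
    show "g \<in> edge_choices G T"
    proof (rule edge_choicesI)
      show "g \<in> extensional T" by (simp add: g_def)
      show "{u, g u} \<in> edges G" if "u \<in> T" for u using ME'[OF g[OF that]] by blast
      show "inj_on (\<lambda>u. {u, g u}) T"
      proof (rule inj_onI)
        fix u w assume uw: "u \<in> T" "w \<in> T" "{u, g u} = {w, g w}"
        have "{Inl u, Inr {u, g u}} = {Inl w, Inr {w, g w}}"
          using g[OF uw(1)] g[OF uw(2)] unfolding uw(3) by (rule disj) blast
        then show "u = w" by (auto simp: doubleton_eq_iff)
      qed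
    qed
    show "M = choice_matching T g"
    proof
      show "choice_matching T g \<subseteq> M" using g by (auto simp: choice_matching_def)
      show "M \<subseteq> choice_matching T g"
      proof
        fix f assume f: "f \<in> M"
        then obtain u e where ue: "f = {Inl u, Inr e}" using ME by blast
        then have "u \<in> T" using f by (auto simp: T_def)
        then have "f = {Inl u, Inr {u, g u}}" using disj[OF f g] ue by blast
        then show "f \<in> choice_matching T g" using \<open>u \<in> T\<close> by (simp add: choice_matching_def)
      qed
    qed
  qed
qed

lemma weighted_matching_number_delete_subdivision:
  assumes G: "simple_graph G" and C: "subgraph_of C G"
  shows "weighted_matching_number (delete_subgraph (subdivision_graph G) (subdivision_graph C))
      (subdivision_weight \<omega>) k =
    (\<Sum>T | T \<subseteq> vertices G - vertices C \<and> int (card T) = k.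
      real (card (edge_choices G T)) * (\<Prod>u\<in>T. 1 / \<omega> u))"
proof -
  let ?H = "delete_subgraph (subdivision_graph G) (subdivision_graph C)"
  let ?\<T> = "{T. T \<subseteq> vertices G - vertices C \<and> int (card T) = k}"
  let ?P = "SIGMA T:?\<T>. edge_choices G T"
  have finV: "finite (vertices G)" using G by (simp add: simple_graph_def)
  have inj: "inj_on (\<lambda>(T, g). choice_matching T g) ?P"
  proof (rule inj_onI)
    fix p p' assume p: "p \<in> ?P" "p' \<in> ?P"
      "(case p of (T, g) \<Rightarrow> choice_matching T g) = (case p' of (T, g) \<Rightarrow> choice_matching T g)"
    obtain T g T' g' where pp: "p = (T, g)" "p' = (T', g')" by (cases p, cases p')
    have g: "g \<in> edge_choices G T" "g' \<in> edge_choices G T'"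
      and eq: "choice_matching T g = choice_matching T' g'"
      using p by (simp_all add: pp)
    have *: "u \<in> T \<and> e = {u, g u} \<longleftrightarrow> u \<in> T' \<and> e = {u, g' u}" for u e
      using choice_matching_iff[of u e T g] choice_matching_iff[of u e T' g'] eq by simp
    then have T: "T = T'" by auto
    have "g = g'"
    proof (rule PiE_ext)
      show "g \<in> PiE T (neighbours G)" "g' \<in> PiE T (neighbours G)"
        using g T by (auto simp: edge_choices_def)
      fix u assume "u \<in> T"
      then have "{u, g u} = {u, g' u}" using * by blast
      then show "g u = g' u" by (auto simp: doubleton_eq_iff)
    qed
    then show "p = p'" using T pp by simp
  qed
  have img: "{M. graph_matching ?H M \<and> int (card M) = k} = (\<lambda>(T, g). choice_matching T g) ` ?P"
  proof (intro equalityI subsetI)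
    fix M assume "M \<in> {M. graph_matching ?H M \<and> int (card M) = k}"
    then have M: "graph_matching ?H M" "int (card M) = k" by auto
    obtain T g where "T \<subseteq> vertices G - vertices C" "g \<in> edge_choices G T" "M = choice_matching T g"
      by (rule graph_matching_is_choice_matching[OF G C M(1)])
    then show "M \<in> (\<lambda>(T, g). choice_matching T g) ` ?P"
      using M(2) by (intro image_eqI[of _ _ "(T, g)"]) (auto simp: card_choice_matching)
  next
    fix M assume "M \<in> (\<lambda>(T, g). choice_matching T g) ` ?P"
    then obtain T g where "T \<subseteq> vertices G - vertices C" "int (card T) = k" "g \<in> edge_choices G T"
      "M = choice_matching T g" by blast
    then show "M \<in> {M. graph_matching ?H M \<and> int (card M) = k}"
      using graph_matching_choice_matching[OF G C] card_choice_matching[of T g] by simp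
  qed
  have weight: "(\<Prod>f\<in>choice_matching T g. subdivision_weight \<omega> f) = (\<Prod>u\<in>T. 1 / \<omega> u)" for T g
    unfolding choice_matching_def prod.reindex[OF inj_choice_matching_edge]
    by (simp add: subdivision_weight_edge)
  have "weighted_matching_number ?H (subdivision_weight \<omega>) k =
      (\<Sum>(T, g)\<in>?P. \<Prod>u\<in>T. 1 / \<omega> u)"
    unfolding weighted_matching_number_def img sum.reindex[OF inj]
    by (intro sum.cong) (auto simp: weight)
  also have "\<dots> = (\<Sum>T\<in>?\<T>. \<Sum>g\<in>edge_choices G T. \<Prod>u\<in>T. 1 / \<omega> u)"
  proof (rule sum.Sigma[symmetric])
    show "finite ?\<T>" using finV by simp
    show "\<forall>T\<in>?\<T>. finite (edge_choices G T)"
    proof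
      fix T assume "T \<in> ?\<T>"
      then have "T \<subseteq> vertices G" by auto
      then have "finite T" using finV by (rule finite_subset)
      then show "finite (edge_choices G T)" by (rule finite_edge_choices[OF G])
    qed
  qed
  finally show ?thesis by simp
qed

section \<open>The weighted Kirchhoff index\<close>

text \<open>
  A matching of the subdivision graph with \<open>S(C)\<close> removed covers a set \<open>T\<close> of old vertices
  outside \<open>C\<close>. Put \<open>S = T \<union> V(C)\<close>: the weights \<open>1 / \<omega> u\<close> on \<open>T\<close> cancel, and the product of the
  weights outside \<open>S\<close> remains. It depends on \<open>S\<close> only, so the sum over \<open>C\<close> can be carried out first.
\<close>

lemma sum_two_regular_eq_sum_rooted_forests:
  fixes \<omega> :: "'a \<Rightarrow> real"
  assumes G: "simple_graph G" and \<omega>: "\<And>u. u \<in> vertices G \<Longrightarrow> \<omega> u \<noteq> 0"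
  shows "(\<Sum>C\<in>two_regular_within G (vertices G). (- 2) ^ num_cycles C
      * weighted_matching_number (delete_subgraph (subdivision_graph G) (subdivision_graph C))
          (subdivision_weight \<omega>) (k - int (card (vertices C)))
      * (\<Prod>u\<in>vertices G - vertices C. \<omega> u)) =
    (\<Sum>S | S \<subseteq> vertices G \<and> int (card S) = k.
      (\<Prod>u\<in>vertices G - S. \<omega> u) * real (card (rooted_forests G S)))"
proof -
  let ?V = "vertices G"
  let ?\<S> = "{S. S \<subseteq> ?V \<and> int (card S) = k}"
  let ?t = "\<lambda>C S. (\<Prod>u\<in>?V - S. \<omega> u) * ((- 2) ^ num_cycles C * real (card (edge_choices G (S - vertices C))))"
  have finV: "finite ?V" using G by (simp add: simple_graph_def)
  have "(- 2) ^ num_cycles C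
      * weighted_matching_number (delete_subgraph (subdivision_graph G) (subdivision_graph C))
          (subdivision_weight \<omega>) (k - int (card (vertices C)))
      * (\<Prod>u\<in>?V - vertices C. \<omega> u) = (\<Sum>S | S \<in> ?\<S> \<and> vertices C \<subseteq> S. ?t C S)"
    if "C \<in> two_regular_within G ?V" for C
  proof -
    have C: "subgraph_of C G" "vertices C \<subseteq> ?V"
      using that by (auto simp: two_regular_within_def)
    have finC: "finite (vertices C)" using C(2) finV by (rule finite_subset)
    let ?\<T> = "{T. T \<subseteq> ?V - vertices C \<and> int (card T) = k - int (card (vertices C))}"
    have "(- 2) ^ num_cycles C * (\<Sum>T\<in>?\<T>. real (card (edge_choices G T)) * (\<Prod>u\<in>T. 1 / \<omega> u))
        * (\<Prod>u\<in>?V - vertices C. \<omega> u) =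
      (\<Sum>T\<in>?\<T>. (- 2) ^ num_cycles C * (real (card (edge_choices G T)) * (\<Prod>u\<in>T. 1 / \<omega> u))
        * (\<Prod>u\<in>?V - vertices C. \<omega> u))"
      by (simp only: sum_distrib_left sum_distrib_right)
    also have "\<dots> = (\<Sum>S | S \<in> ?\<S> \<and> vertices C \<subseteq> S. ?t C S)"
    proof (rule sum.reindex_bij_witness[of _ "\<lambda>S. S - vertices C" "\<lambda>T. T \<union> vertices C"])
      fix T assume "T \<in> ?\<T>"
      then have T: "T \<subseteq> ?V - vertices C" "int (card T + card (vertices C)) = k" by auto
      then have finT: "finite T" using finV finite_subset by blast
      show "T \<union> vertices C - vertices C = T" using T by blast
      then have "?t C (T \<union> vertices C) =
          (\<Prod>u\<in>?V - (T \<union> vertices C). \<omega> u) * ((- 2) ^ num_cycles C * real (card (edge_choices G T)))"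
        by simp
      moreover have "(\<Prod>u\<in>?V - (T \<union> vertices C). \<omega> u) = (\<Prod>u\<in>T. 1 / \<omega> u) * (\<Prod>u\<in>?V - vertices C. \<omega> u)"
      proof -
        have "(\<Prod>u\<in>?V - vertices C. \<omega> u) = (\<Prod>u\<in>?V - vertices C - T. \<omega> u) * (\<Prod>u\<in>T. \<omega> u)"
          using T(1) finV by (intro prod.subset_diff) auto
        moreover have "(\<Prod>u\<in>T. 1 / \<omega> u) * (\<Prod>u\<in>T. \<omega> u) = 1"
        proof -
          have "(\<Prod>u\<in>T. 1 / \<omega> u * \<omega> u) = 1" using T(1) \<omega> by (intro prod.neutral) auto
          then show ?thesis by (simp only: prod.distrib)
        qed
        moreover have "?V - (T \<union> vertices C) = ?V - vertices C - T" by blast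
        ultimately show ?thesis by (simp add: algebra_simps)
      qed
      ultimately show "?t C (T \<union> vertices C) = (- 2) ^ num_cycles C *
          (real (card (edge_choices G T)) * (\<Prod>u\<in>T. 1 / \<omega> u)) * (\<Prod>u\<in>?V - vertices C. \<omega> u)"
        by (simp only: mult_ac)
      have "card (T \<union> vertices C) = card T + card (vertices C)"
        using T(1) finT finC by (intro card_Un_disjoint) auto
      then show "T \<union> vertices C \<in> {S. S \<in> ?\<S> \<and> vertices C \<subseteq> S}" using T C(2) by auto
    next
      fix S assume "S \<in> {S. S \<in> ?\<S> \<and> vertices C \<subseteq> S}"
      then have S: "S \<subseteq> ?V" "int (card S) = k" "vertices C \<subseteq> S" by auto
      show "S - vertices C \<union> vertices C = S" using S by blast
      have finS: "finite S" using S(1) finV by (rule finite_subset)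
      have "card (S - vertices C) = card S - card (vertices C)" "card (vertices C) \<le> card S"
        using S finS finC by (auto simp: card_Diff_subset intro: card_mono)
      then show "S - vertices C \<in> ?\<T>" using S(1,2) by auto
    qed
    finally show ?thesis
      unfolding weighted_matching_number_delete_subdivision[OF G C(1)] .
  qed
  then have "(\<Sum>C\<in>two_regular_within G ?V. (- 2) ^ num_cycles C
      * weighted_matching_number (delete_subgraph (subdivision_graph G) (subdivision_graph C))
          (subdivision_weight \<omega>) (k - int (card (vertices C)))
      * (\<Prod>u\<in>?V - vertices C. \<omega> u)) =
    (\<Sum>C\<in>two_regular_within G ?V. \<Sum>S | S \<in> ?\<S> \<and> vertices C \<subseteq> S. ?t C S)"
    by (rule sum.cong[OF refl])
  also have "\<dots> = (\<Sum>S\<in>?\<S>. \<Sum>C | C \<in> two_regular_within G ?V \<and> vertices C \<subseteq> S. ?t C S)"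
    by (rule sum.swap_restrict[OF finite_two_regular_within[OF G]]) (use finV in auto)
  also have "\<dots> = (\<Sum>S\<in>?\<S>. (\<Prod>u\<in>?V - S. \<omega> u) * real (card (rooted_forests G S)))"
  proof (rule sum.cong[OF refl])
    fix S assume "S \<in> ?\<S>"
    then have S: "S \<subseteq> ?V" and finS: "finite S" using finV finite_subset by auto
    have "{C. C \<in> two_regular_within G ?V \<and> vertices C \<subseteq> S} = two_regular_within G S"
      using S by (auto simp: two_regular_within_def)
    then show "(\<Sum>C | C \<in> two_regular_within G ?V \<and> vertices C \<subseteq> S. ?t C S) =
        (\<Prod>u\<in>?V - S. \<omega> u) * real (card (rooted_forests G S))"
      by (simp only: card_rooted_forests_expansion[OF G finS] sum_distrib_left)
  qed
  finally show ?thesis .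
qed

lemma two_regular_within_vertices:
  assumes "simple_graph G"
  shows "two_regular_within G (vertices G) = insert ({}, {}) (two_regular_subgraphs G)"
proof (intro equalityI subsetI)
  fix C assume "C \<in> two_regular_within G (vertices G)"
  then have C: "subgraph_of C G" "two_regular C" by (auto simp: two_regular_within_def)
  show "C \<in> insert ({}, {}) (two_regular_subgraphs G)"
  proof (cases "vertices C = {}")
    case True
    then show ?thesis using C(2) simple_graph_no_vertices[of C] by (simp add: two_regular_def)
  next
    case False
    then show ?thesis using C unfolding two_regular_subgraphs_def two_regular_def by blast
  qed
next
  fix C assume "C \<in> insert ({}, {}) (two_regular_subgraphs G)"
  then consider "C = ({}, {})" | "C \<in> two_regular_subgraphs G" by blast
  then show "C \<in> two_regular_within G (vertices G)"
    by cases (simp_all add: two_regular_within_def subgraph_of_def two_regular_def simple_graph_def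
        two_regular_subgraphs_def)
qed

text \<open>
  Pairs \<open>i < j\<close> correspond to the sets \<open>S\<close> obtained by leaving out two vertices, and \<open>\<tau>(G)\<close>
  cancels the denominator of the resistance.
\<close>

lemma weighted_kirchhoff_index_eq_rooted_forests:
  fixes \<omega> :: "'a \<Rightarrow> real"
  assumes G: "connected_graph G" and bij: "bij_betw v {1..n} (vertices G)"
    and x: "\<And>i. i \<in> {1..n} \<Longrightarrow> \<omega> (v i) = x i"
  shows "real (num_spanning_trees G) * weighted_kirchhoff_index G n v x =
    (\<Sum>S | S \<subseteq> vertices G \<and> int (card S) = int n - 2.
      (\<Prod>u\<in>vertices G - S. \<omega> u) * real (card (rooted_forests G S)))"
proof -
  let ?V = "vertices G"
  let ?I = "{(i, j). 1 \<le> i \<and> i < j \<and> j \<le> n}"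
  let ?\<S> = "{S. S \<subseteq> ?V \<and> int (card S) = int n - 2}"
  let ?S = "\<lambda>(i, j). ?V - {v i, v j}"
  have finV: "finite ?V" using G by (simp add: connected_graph_def simple_graph_def)
  have cardV: "card ?V = n" using bij_betw_same_card[OF bij] by simp
  have vV: "v i \<in> ?V" if "1 \<le> i" "i \<le> n" for i using bij that by (auto simp: bij_betw_def)
  have vinj: "v i = v j \<longleftrightarrow> i = j" if "1 \<le> i" "i \<le> n" "1 \<le> j" "j \<le> n" for i j
    using inj_on_eq_iff[OF bij_betw_imp_inj_on[OF bij], of i j] that by simp
  have inj: "inj_on ?S ?I"
  proof (rule inj_onI)
    fix p p' assume p: "p \<in> ?I" "p' \<in> ?I" "?S p = ?S p'"
    obtain i j i' j' where pp: "p = (i, j)" "p' = (i', j')" by (cases p, cases p')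
    have ij: "1 \<le> i" "i < j" "j \<le> n" "1 \<le> i'" "i' < j'" "j' \<le> n"
      and eq: "?V - {v i, v j} = ?V - {v i', v j'}"
      using p by (simp_all add: pp)
    have "{v i, v j} = {v i', v j'}"
      using eq vV[of i] vV[of j] vV[of i'] vV[of j'] ij by auto
    then show "p = p'"
      unfolding pp using ij vinj[of i i'] vinj[of j j'] vinj[of i j'] vinj[of j i'] by (auto simp: doubleton_eq_iff)
  qed
  have img: "?S ` ?I = ?\<S>"
  proof (intro equalityI subsetI)
    fix S assume "S \<in> ?S ` ?I"
    then obtain i j where ij: "1 \<le> i" "i < j" "j \<le> n" "S = ?V - {v i, v j}" by auto
    have "card {v i, v j} = 2" "{v i, v j} \<subseteq> ?V" using ij vinj[of i j] vV by auto
    then have "card S = n - 2" "2 \<le> n"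
      using ij finV cardV by (auto simp: card_Diff_subset)
    then show "S \<in> ?\<S>" using ij(4) by auto
  next
    fix S assume "S \<in> ?\<S>"
    then have S: "S \<subseteq> ?V" "card S + 2 = n" by auto
    then have "card (?V - S) = 2"
      using finV cardV by (simp add: card_Diff_subset finite_subset)
    then obtain a b where ab: "?V - S = {a, b}" "a \<noteq> b" by (auto simp: card_2_iff)
    then have "a \<in> v ` {1..n}" "b \<in> v ` {1..n}" using bij by (auto simp: bij_betw_def)
    then obtain i j where ij: "i \<in> {1..n}" "a = v i" "j \<in> {1..n}" "b = v j" by auto
    have S': "S = ?V - {a, b}" using ab(1) S(1) by blast
    have "i \<noteq> j" using ij ab by auto
    then show "S \<in> ?S ` ?I"
    proof (cases "i < j")
      case True
      then show ?thesis using ij S' by (intro image_eqI[of _ _ "(i, j)"]) auto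
    next
      case False
      then show ?thesis using ij S' \<open>i \<noteq> j\<close>
        by (intro image_eqI[of _ _ "(j, i)"]) (auto simp: insert_commute)
    qed
  qed
  have summand: "real (num_spanning_trees G) * (x i * x j * resistance_distance G (v i) (v j)) =
      (\<Prod>u\<in>?V - ?S (i, j). \<omega> u) * real (card (rooted_forests G (?S (i, j))))"
    if "1 \<le> i" "i < j" "j \<le> n" for i j
  proof -
    have ij: "v i \<in> ?V" "v j \<in> ?V" "v i \<noteq> v j" using vV vinj[of i j] that by auto
    have "resistance_distance G (v i) (v j) =
        card (rooted_forests G (?V - {v i, v j})) / num_spanning_trees G"
      using card_rooted_forests_eq_num_spanning_trees[OF G] num_spanning_trees_pos[OF G]
      by (intro resistance_distance_eq_forests G ij) auto
    moreover have "?V - ?S (i, j) = {v i, v j}" using ij by auto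
    moreover have "\<omega> (v i) = x i" "\<omega> (v j) = x j" using x that by auto
    ultimately show ?thesis using ij num_spanning_trees_pos[OF G] by simp
  qed
  have "real (num_spanning_trees G) * weighted_kirchhoff_index G n v x =
      (\<Sum>(i, j)\<in>?I. real (num_spanning_trees G) * (x i * x j * resistance_distance G (v i) (v j)))"
    unfolding weighted_kirchhoff_index_def sum_distrib_left by (simp add: case_prod_unfold)
  also have "\<dots> = (\<Sum>p\<in>?I. (\<Prod>u\<in>?V - ?S p. \<omega> u) * real (card (rooted_forests G (?S p))))"
    by (rule sum.cong[OF refl]) (use summand in auto)
  also have "\<dots> = (\<Sum>S\<in>?\<S>. (\<Prod>u\<in>?V - S. \<omega> u) * real (card (rooted_forests G S)))"
    unfolding img[symmetric] by (subst sum.reindex[OF inj]) (simp add: o_def)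
  finally show ?thesis .
qed

theorem theorem2p9:
  fixes G :: "'a ugraph" and n :: nat and v :: "nat \<Rightarrow> 'a"
    and \<omega> :: "'a \<Rightarrow> real" and x :: "nat \<Rightarrow> real"
  assumes "connected_graph G"
    and "bij_betw v {1..n} (vertices G)"
    and "\<And>u. u \<in> vertices G \<Longrightarrow> \<omega> u > 0"
    and "\<And>i. i \<in> {1..n} \<Longrightarrow> \<omega> (v i) = x i"
  shows "weighted_kirchhoff_index G n v x =
    1 / real (num_spanning_trees G) *
    (weighted_matching_number (subdivision_graph G) (subdivision_weight \<omega>) (int n - 2)
       * (\<Prod>i=1..n. x i)
     + (\<Sum>C\<in>two_regular_subgraphs G.
          (- 2) ^ num_cycles C
          * weighted_matching_number
              (delete_subgraph (subdivision_graph G) (subdivision_graph C))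
              (subdivision_weight \<omega>) (int n - 2 - int (card (vertices C)))
          * (\<Prod>i | i \<in> {1..n} \<and> v i \<notin> vertices C. x i)))"
proof -
  have G: "simple_graph G" using assms(1) by (simp add: connected_graph_def)
  define t where "t C = (- 2) ^ num_cycles C
      * weighted_matching_number (delete_subgraph (subdivision_graph G) (subdivision_graph C))
          (subdivision_weight \<omega>) (int n - 2 - int (card (vertices C)))
      * (\<Prod>u\<in>vertices G - vertices C. \<omega> u)" for C
  have prod: "(\<Prod>u\<in>vertices G - A. \<omega> u) = (\<Prod>i | i \<in> {1..n} \<and> v i \<notin> A. x i)" for A
  proof -
    have "bij_betw v {i. i \<in> {1..n} \<and> v i \<notin> A} (vertices G - A)"
    proof (rule bij_betw_subset[OF assms(2)])
      show "v ` {i. i \<in> {1..n} \<and> v i \<notin> A} = vertices G - A"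
        unfolding bij_betw_imp_surj_on[OF assms(2), symmetric] by blast
    qed blast
    then have "(\<Prod>u\<in>vertices G - A. \<omega> u) = (\<Prod>i | i \<in> {1..n} \<and> v i \<notin> A. \<omega> (v i))"
      by (rule prod.reindex_bij_betw[symmetric])
    then show ?thesis using assms(4) by simp
  qed
  have empty: "t ({}, {}) = weighted_matching_number (subdivision_graph G) (subdivision_weight \<omega>) (int n - 2)
       * (\<Prod>i=1..n. x i)"
  proof -
    have "delete_subgraph (subdivision_graph G) (subdivision_graph ({}, {})) = subdivision_graph G"
      by (simp add: delete_subgraph_def subdivision_graph_def)
    moreover have "(\<Prod>u\<in>vertices G. \<omega> u) = (\<Prod>i=1..n. x i)"
      using prod.reindex_bij_betw[OF assms(2), of \<omega>] assms(4) by simp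
    ultimately show ?thesis by (simp add: t_def num_cycles_empty)
  qed
  have fin: "finite (two_regular_subgraphs G)"
    using finite_two_regular_within[OF G, of "vertices G"] two_regular_within_vertices[OF G] by simp
  have "real (num_spanning_trees G) * weighted_kirchhoff_index G n v x =
      (\<Sum>S | S \<subseteq> vertices G \<and> int (card S) = int n - 2.
        (\<Prod>u\<in>vertices G - S. \<omega> u) * real (card (rooted_forests G S)))"
    using assms(1,2,4) by (rule weighted_kirchhoff_index_eq_rooted_forests)
  also have "\<dots> = (\<Sum>C\<in>two_regular_within G (vertices G). t C)"
    unfolding t_def using assms(3) G
    by (intro sum_two_regular_eq_sum_rooted_forests[symmetric]) force+
  also have "\<dots> = t ({}, {}) + (\<Sum>C\<in>two_regular_subgraphs G. t C)"
    unfolding two_regular_within_vertices[OF G]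
    using fin by (subst sum.insert) (auto simp: two_regular_subgraphs_def)
  finally show ?thesis
    unfolding empty using num_spanning_trees_pos[OF assms(1)]
    by (simp add: t_def prod field_simps)
qed

end
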